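(* For all integers $l\ge1$ and $m\ge0$, the sequence of matrices $(\mathbf{D}_N(d^{l,m}))_{N\ge1}$ is strongly stable.
   Context: $\mathbb{N}=\{0,1,2,\dots\}$; for $N\ge1$, $h=\frac1{N+1}$. Formulas. $\mathscr{S}_{\mathbb{C}}$ is the set of finitely supported complex sequences $b=(b_j)_{j\in\mathbb{Z}}$ with $b_j=b_{-j}$; $\tau(b)=\max\{j: b_j\neq0\}$, $\tau(0)=-\infty$. For $n\in2\mathbb{N}$, $(d,s)\in\mathscr{S}_{\mathbb{C}}^2$ is consistent of order $n$ if for every $u\in C^\infty(\mathbb{R})$, $\sum_{j}\big(d_ju(jh)+h^2s_ju''(jh)\big)=\mathcal{O}(h^{n+2})$ as $h\to0^+$; $\operatorname{ord}(d,s)$ is the supremum of the $n\in2\mathbb{N}$ such that $(d,s)$ is consistent of order $n$. Optimal formulas. For $l,m\in\mathbb{N}$, the maximum of $\operatorname{ord}(d,s)$ over $(d,s)\in\mathscr{S}_{\mathbb{C}}^2\setminus\{(0,0)\}$ with $\tau(d)\le l+1$, $\tau(s)\le m$ equals $2(l+m+1)$; it is attained by a pair that is unique up to multiplication by a scalar, and $(d^{l,m},s^{l,m})$ denotes the unique maximizing pair normalized by $\sum_{j\in\mathbb{Z}}d^{l,m}_jj^2=-2$. The matrix $\mathbf{D}_N(d)$. For $d\in\mathscr{S}_{\mathbb{C}}$ let $T_d(w)=d\star w=\big(\sum_jd_jw_{i-j}\big)_{i\in\mathbb{Z}}$ for $w\in\mathbb{C}^{\mathbb{Z}}$. Let $\mathscr{E}_N=\{w\in\mathbb{C}^{\mathbb{Z}}: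 w_{-j}=-w_j,\ w_{N+1+j}=-w_{N+1-j}\ \forall j\in\mathbb{Z}\}$, which is stable under $T_d$, with basis $\mathscr{B}_N=\big(\mathbb{1}_{j+(2N+2)\mathbb{Z}}-\mathbb{1}_{-j+(2N+2)\mathbb{Z}}\big)_{j=1,\dots,N}$. Then $\mathbf{D}_N(d)\in\mathbb{C}^{N\times N}$ is the matrix in the basis $\mathscr{B}_N$ of the restriction of $T_d$ to $\mathscr{E}_N$. Strong stability. A sequence $(\mathbf{D}_N)_{N\ge1}$, $\mathbf{D}_N\in\mathbb{C}^{N\times N}$, is strongly stable if for every $r\in\mathbb{N}$ there is $c>0$ such that for all $N\ge1$ and all $\mathbf{v}\in\mathbb{C}^N$, $c\|\mathbf{v}\|_\infty\le\max_{1\le j\le N}\omega_j\,|(\mathbf{D}_N\mathbf{v})_j|$, where $\omega_j=h^{-2}$ if $r<j<N+1-r$ and $\omega_j=1$ otherwise. *)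

theory Defs
  imports
    "HOL-Analysis.Derivative"
    "HOL-Library.Extended_Real"
    "HOL-Library.Landau_Symbols"
    "Jordan_Normal_Form.Matrix"
begin

section \<open>Formulas and their order of consistency\<close>

definition sym_seqs :: "(int \<Rightarrow> complex) set" where
  "sym_seqs = {b. finite {j. b j \<noteq> 0} \<and> (\<forall>j. b (- j) = b j)}"

definition tau :: "(int \<Rightarrow> complex) \<Rightarrow> ereal" where
  "tau b = (if b = (\<lambda>_. 0) then - \<infinity> else ereal (of_int (Max {j. b j \<noteq> 0})))"

definition D_iter :: "nat \<Rightarrow> (real \<Rightarrow> complex) \<Rightarrow> real \<Rightarrow> complex" where
  "D_iter k u = ((\<lambda>f x. vector_derivative f (at x)) ^^ k) u"

definition smooth :: "(real \<Rightarrow> complex) \<Rightarrow> bool" where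
  "smooth u \<longleftrightarrow> (\<forall>k x. D_iter k u differentiable (at x))"

definition consistent :: "nat \<Rightarrow> (int \<Rightarrow> complex) \<Rightarrow> (int \<Rightarrow> complex) \<Rightarrow> bool" where
  "consistent n d s \<longleftrightarrow>
     (\<forall>u. smooth u \<longrightarrow>
        (\<lambda>h::real. \<Sum>j | d j \<noteq> 0 \<or> s j \<noteq> 0.
            d j * u (of_int j * h) + of_real (h ^ 2) * s j * D_iter 2 u (of_int j * h))
        \<in> O[at_right 0](\<lambda>h. of_real (h ^ (n + 2))))"

text \<open>The supremum is taken in the extended reals: it is \<open>\<infinity>\<close> if all even orders are attained
  (as for the zero pair) and \<open>-\<infinity>\<close> if none is.\<close>

definition ord_pair :: "(int \<Rightarrow> complex) \<times> (int \<Rightarrow> complex) \<Rightarrow> ereal" where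
  "ord_pair p = Sup {ereal (real n) | n. even n \<and> consistent n (fst p) (snd p)}"

section \<open>Optimal formulas\<close>

definition admissible :: "nat \<Rightarrow> nat \<Rightarrow> (int \<Rightarrow> complex) \<times> (int \<Rightarrow> complex) \<Rightarrow> bool" where
  "admissible l m p \<longleftrightarrow>
     p \<in> sym_seqs \<times> sym_seqs \<and> p \<noteq> (\<lambda>_. 0, \<lambda>_. 0) \<and>
     tau (fst p) \<le> ereal (real (l + 1)) \<and> tau (snd p) \<le> ereal (real m)"

definition opt_pair :: "nat \<Rightarrow> nat \<Rightarrow> (int \<Rightarrow> complex) \<times> (int \<Rightarrow> complex)" where
  "opt_pair l m =
     (THE p. is_arg_max ord_pair (admissible l m) p \<and>
             (\<Sum>j | fst p j \<noteq> 0. fst p j * of_int (j ^ 2)) = - 2)"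

definition d_opt :: "nat \<Rightarrow> nat \<Rightarrow> int \<Rightarrow> complex" where
  "d_opt l m = fst (opt_pair l m)"

section \<open>The matrix of a convolution operator on odd periodic sequences\<close>

definition conv_op :: "(int \<Rightarrow> complex) \<Rightarrow> (int \<Rightarrow> complex) \<Rightarrow> int \<Rightarrow> complex" where
  "conv_op d w = (\<lambda>i. \<Sum>j | d j \<noteq> 0. d j * w (i - j))"

definition E_space :: "nat \<Rightarrow> (int \<Rightarrow> complex) set" where
  "E_space N = {w. \<forall>j. w (- j) = - w j \<and> w (int N + 1 + j) = - w (int N + 1 - j)}"

definition E_basis :: "nat \<Rightarrow> nat \<Rightarrow> int \<Rightarrow> complex" where
  "E_basis N j = (\<lambda>i. indicator (range (\<lambda>k. int j + (2 * int N + 2) * k)) i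
                    - indicator (range (\<lambda>k. - int j + (2 * int N + 2) * k)) i)"

text \<open>The basis is indexed by \<open>1, \<dots>, N\<close>, whereas rows and columns of \<open>mat\<close> start at \<open>0\<close>.\<close>

definition conv_mat :: "nat \<Rightarrow> (int \<Rightarrow> complex) \<Rightarrow> complex mat" where
  "conv_mat N d =
     (THE A. A \<in> carrier_mat N N \<and>
        (\<forall>k\<in>{1..N}. conv_op d (E_basis N k) =
                      (\<lambda>i. \<Sum>j = 1..N. A $$ (j - 1, k - 1) * E_basis N j i)))"

text \<open>The next facts justify the definite description in \<open>conv_mat\<close>: \<open>E_space N\<close> is stable
  under convolution by a symmetric sequence and \<open>E_basis N\<close> is a basis of it.\<close>

lemma E_space_periodic:
  assumes "w \<in> E_space N"
  shows "w (i + (2 * int N + 2) * k) = w i"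
proof -
  have step: "w (i + (2 * int N + 2)) = w i" for i
  proof -
    have "w (int N + 1 + (int N + 1 + i)) = - w (int N + 1 - (int N + 1 + i))"
      using assms unfolding E_space_def by blast
    also have "\<dots> = w i"
      using assms unfolding E_space_def by simp
    finally show ?thesis by (simp add: algebra_simps)
  qed
  have nat_step: "w (i + (2 * int N + 2) * int n) = w i" for i n
  proof (induction n)
    case (Suc n)
    have "i + (2 * int N + 2) * int (Suc n) = (i + (2 * int N + 2) * int n) + (2 * int N + 2)"
      by (simp add: algebra_simps)
    then show ?case using Suc step by metis
  qed simp
  show ?thesis
  proof (cases "k \<ge> 0")
    case True
    then show ?thesis using nat_step[of i "nat k"] by simp
  next
    case False
    then show ?thesis using nat_step[of "i + (2 * int N + 2) * k" "nat (- k)"]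
      by (simp add: algebra_simps)
  qed
qed

lemma E_space_eqI:
  assumes w: "w \<in> E_space N" and v: "v \<in> E_space N"
    and eq: "\<And>i. i \<in> {1..N} \<Longrightarrow> w (int i) = v (int i)"
  shows "w = v"
proof
  fix i
  define p where "p = 2 * int N + 2"
  define r where "r = i mod p"
  have r: "0 \<le> r" "r < p" by (simp_all add: r_def p_def)
  have ir: "i = r + p * (i div p)" by (simp add: r_def)
  have odd: "f (- j) = - f j" if "f \<in> E_space N" for f j
    using that by (simp add: E_space_def)
  have zero: "f 0 = 0" "f (int N + 1) = 0" if "f \<in> E_space N" for f
  proof -
    show "f 0 = 0" using odd[OF that, of 0] by simp
    have "f (int N + 1 + 0) = - f (int N + 1 - 0)"
      using that unfolding E_space_def by blast
    then show "f (int N + 1) = 0" by simp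
  qed
  have small: "w j = v j" if "1 \<le> j" "j \<le> int N" for j
    using eq[of "nat j"] that by (simp add: nat_le_iff Suc_le_eq)
  have refl: "f r = - f (p - r)" if "f \<in> E_space N" for f
    using E_space_periodic[OF that, of "- r" 1] odd[OF that, of r] by (simp add: p_def)
  consider "r = 0" | "1 \<le> r \<and> r \<le> int N" | "r = int N + 1" | "int N + 2 \<le> r" using r by linarith
  then have "w r = v r"
  proof cases
    case 4
    then have "w (p - r) = v (p - r)" using r small[of "p - r"] by (simp add: p_def)
    then show ?thesis using refl[OF w] refl[OF v] by simp
  qed (use zero[OF w] zero[OF v] small in simp_all)
  then show "w i = v i"
    using E_space_periodic[OF w, of r "i div p"] E_space_periodic[OF v, of r "i div p"] ir
    by (simp add: p_def)
qed

lemma mem_range_iff_dvd: "x \<in> range (\<lambda>k. c + p * k) \<longleftrightarrow> p dvd x - c" for x c p :: int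
proof -
  have "x = c + p * k \<longleftrightarrow> x - c = p * k" for k by auto
  then show ?thesis by (simp add: image_iff dvd_def)
qed

lemma E_basis_alt:
  "E_basis N j i = of_bool (2 * int N + 2 dvd i - int j) - of_bool (2 * int N + 2 dvd i + int j)"
  unfolding E_basis_def indicator_def mem_range_iff_dvd by simp

lemma E_basis_in_E_space: "E_basis N j \<in> E_space N"
proof -
  define p where "p = 2 * int N + 2"
  have neg: "p dvd - i - c \<longleftrightarrow> p dvd i + c" for c i
    using dvd_minus_iff[of p "i + c"] by simp
  have refl: "p dvd int N + 1 + i - c \<longleftrightarrow> p dvd int N + 1 - i + c" for c i
  proof -
    have "int N + 1 + i - c = p - (int N + 1 - i + c)" by (simp add: p_def)
    then show ?thesis by (metis dvd_refl dvd_diff_right_iff)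
  qed
  have "E_basis N j (- i) = - E_basis N j i" for i
    using neg[of i "int j"] neg[of i "- int j"]
    by (simp only: E_basis_alt p_def[symmetric]) (simp add: p_def)
  moreover have "E_basis N j (int N + 1 + i) = - E_basis N j (int N + 1 - i)" for i
    using refl[of i "int j"] refl[of i "- int j"]
    by (simp add: E_basis_alt p_def[symmetric])
  ultimately show ?thesis by (simp add: E_space_def)
qed

lemma E_basis_diag:
  assumes "i \<in> {1..N}" "j \<in> {1..N}"
  shows "E_basis N j (int i) = (if i = j then 1 else 0)"
proof -
  have "2 * int N + 2 dvd int i - int j \<longleftrightarrow> i = j"
  proof
    assume dvd: "2 * int N + 2 dvd int i - int j"
    show "i = j"
    proof (rule ccontr)
      assume "i \<noteq> j"
      then have "\<bar>2 * int N + 2\<bar> \<le> \<bar>int i - int j\<bar>" using dvd by (intro dvd_imp_le_int) auto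
      moreover have "int i \<le> int N" "int j \<le> int N" using assms by auto
      ultimately show False by linarith
    qed
  qed simp
  moreover have "\<not> 2 * int N + 2 dvd int i + int j"
    using assms by (intro zdvd_not_zless) auto
  ultimately show ?thesis by (simp add: E_basis_alt)
qed

lemma E_space_lincomb: "(\<lambda>i. \<Sum>j = 1..N. c j * E_basis N j i) \<in> E_space N"
proof -
  have "E_basis N j (- i) = - E_basis N j i"
    "E_basis N j (int N + 1 + i) = - E_basis N j (int N + 1 - i)" for i j
    using E_basis_in_E_space[of N j] by (auto simp: E_space_def)
  then show ?thesis by (simp add: E_space_def sum_negf)
qed

lemma E_lincomb_at:
  assumes "i \<in> {1..N}"
  shows "(\<Sum>j = 1..N. c j * E_basis N j (int i)) = c i"
proof -
  have "(\<Sum>j = 1..N. c j * E_basis N j (int i)) = (\<Sum>j = 1..N. if i = j then c j else 0)"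
    using assms by (intro sum.cong) (auto simp: E_basis_diag)
  then show ?thesis using assms by simp
qed

lemma E_basis_expansion:
  assumes "w \<in> E_space N"
  shows "w = (\<lambda>i. \<Sum>j = 1..N. w (int j) * E_basis N j i)"
  by (rule E_space_eqI[OF assms E_space_lincomb]) (simp only: E_lincomb_at)

lemma conv_op_E_space:
  assumes d: "d \<in> sym_seqs" and w: "w \<in> E_space N"
  shows "conv_op d w \<in> E_space N"
proof -
  have sym: "(\<Sum>j | d j \<noteq> 0. d j * f (- j)) = (\<Sum>j | d j \<noteq> 0. d j * f j)" for f :: "int \<Rightarrow> complex"
    by (rule sum.reindex_bij_witness[of _ uminus uminus])
       (use d in \<open>auto simp: sym_seqs_def\<close>)
  have "conv_op d w (- i) = - conv_op d w i" for i
  proof -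
    have "w (- i - - j) = - w (i - j)" for j
      using w unfolding E_space_def by (metis (mono_tags) mem_Collect_eq minus_diff_minus)
    then show ?thesis
      using sym[of "\<lambda>j. w (- i - j)"] by (simp add: conv_op_def sum_negf)
  qed
  moreover have "conv_op d w (int N + 1 + i) = - conv_op d w (int N + 1 - i)" for i
  proof -
    have "w (int N + 1 + i - - j) = - w (int N + 1 - i - j)" for j
    proof -
      have "w (int N + 1 + (i + j)) = - w (int N + 1 - (i + j))"
        using w unfolding E_space_def by blast
      then show ?thesis by (simp add: algebra_simps)
    qed
    then show ?thesis
      using sym[of "\<lambda>j. w (int N + 1 + i - j)"] by (simp add: conv_op_def sum_negf)
  qed
  ultimately show ?thesis by (simp add: E_space_def)
qed

lemma conv_mat_eq:
  assumes "d \<in> sym_seqs"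
  shows "conv_mat N d = mat N N (\<lambda>(i, k). conv_op d (E_basis N (k + 1)) (int (i + 1)))"
    (is "_ = ?M")
  unfolding conv_mat_def
proof (rule the_equality)
  have "conv_op d (E_basis N k) = (\<lambda>i. \<Sum>j = 1..N. ?M $$ (j - 1, k - 1) * E_basis N j i)"
    if "k \<in> {1..N}" for k
  proof -
    have "conv_op d (E_basis N k) \<in> E_space N"
      by (rule conv_op_E_space[OF assms E_basis_in_E_space])
    then have "conv_op d (E_basis N k) =
        (\<lambda>i. \<Sum>j = 1..N. conv_op d (E_basis N k) (int j) * E_basis N j i)"
      by (rule E_basis_expansion)
    also have "\<dots> = (\<lambda>i. \<Sum>j = 1..N. ?M $$ (j - 1, k - 1) * E_basis N j i)"
      using that by (intro ext sum.cong) (auto simp: of_nat_diff)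
    finally show ?thesis .
  qed
  then show "?M \<in> carrier_mat N N \<and> (\<forall>k\<in>{1..N}. conv_op d (E_basis N k) =
                (\<lambda>i. \<Sum>j = 1..N. ?M $$ (j - 1, k - 1) * E_basis N j i))"
    by auto
next
  fix A
  assume A: "A \<in> carrier_mat N N \<and> (\<forall>k\<in>{1..N}. conv_op d (E_basis N k) =
                (\<lambda>i. \<Sum>j = 1..N. A $$ (j - 1, k - 1) * E_basis N j i))"
  show "A = ?M"
  proof (rule eq_matI)
    fix i k assume "i < dim_row ?M" "k < dim_col ?M"
    then have ik: "i + 1 \<in> {1..N}" "k + 1 \<in> {1..N}" by auto
    have "conv_op d (E_basis N (k + 1)) (int (i + 1)) =
        (\<Sum>j = 1..N. A $$ (j - 1, (k + 1) - 1) * E_basis N j (int (i + 1)))"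
      using A ik(2) by metis
    also have "\<dots> = A $$ (i, k)" by (subst E_lincomb_at[OF ik(1)]) simp
    finally show "A $$ (i, k) = ?M $$ (i, k)" using ik by simp
  qed (use A in auto)
qed

section \<open>Strong stability\<close>

definition mesh :: "nat \<Rightarrow> real" where
  "mesh N = 1 / (real N + 1)"

definition weight :: "nat \<Rightarrow> nat \<Rightarrow> nat \<Rightarrow> real" where
  "weight r N j = (if int r < int j \<and> int j < int N + 1 - int r then 1 / mesh N ^ 2 else 1)"

definition strongly_stable :: "(nat \<Rightarrow> complex mat) \<Rightarrow> bool" where
  "strongly_stable D \<longleftrightarrow>
     (\<forall>N\<ge>1. D N \<in> carrier_mat N N) \<and>
     (\<forall>r::nat. \<exists>c::real. c > 0 \<and>
        (\<forall>N\<ge>1. \<forall>v\<in>carrier_vec N.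
           c * Max ((\<lambda>j. cmod (vec_index v (j - 1))) ` {1..N})
             \<le> Max ((\<lambda>j. weight r N j * cmod (vec_index (D N *\<^sub>v v) (j - 1))) ` {1..N})))"

end

theory Submission
  imports Defs
    "HOL-Computational_Algebra.Polynomial_FPS"
    "HOL-Computational_Algebra.Fundamental_Theorem_Algebra"
begin

hide_const (open) Module.smult

text \<open>
  Convolution with a symmetric sequence is a polynomial in the second difference operator
  \<open>lap\<close>. Let \<open>P\<close> and \<open>Q\<close> be the polynomials of \<open>d\<close> and \<open>s\<close> (\<open>symbol\<close>). Tested on exponentials,
  the order conditions become a statement about power series in \<open>y = 2 - 2 cosh X\<close>. One has
  \<open>- X\<^sup>2 = y G(y)\<close>, where \<open>G(y) = (4 / y) arcsin\<^sup>2(\<surd>y / 2) = \<Sum>k. g\<^sub>k y\<^sup>k\<close>; hence order at least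
  \<open>2(l + m + 1)\<close> means that \<open>P = y p\<close> and \<open>p - G Q = O(y\<^bsup>l+m+1\<^esup>)\<close>, that is, that \<open>p / Q\<close> is the
  \<open>[l/m]\<close> Pade approximant of \<open>G\<close>.

  The core is \<open>pade_numerator_nonzero\<close>: \<open>p\<close> has no zero on \<open>[0, 4]\<close> unless \<open>p = Q = 0\<close>. The \<open>g\<^sub>k\<close> are
  the moments of a linear functional \<open>L\<close> that is positive on nonzero polynomials
  that are nonnegative on \<open>(0, 1/4)\<close>. If \<open>m \<le> l + 1\<close>, put \<open>a = l + 1 - m\<close>. The reversed polynomial \<open>R\<close> of \<open>Q\<close> is then
  orthogonal to lower degrees for the functional \<open>q \<mapsto> L(t\<^sup>a q)\<close>, and for \<open>y = 1/z\<close> and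
  \<open>r = (R - R(z)) / (t - z)\<close> one finds
  \<open>z\<^sup>l p(1/z) R(z) = R(z)\<^sup>2 L((z\<^sup>a - t\<^sup>a) / (z - t)) + L(t\<^sup>a (z - t) r\<^sup>2) > 0\<close>. If \<open>l \<le> m\<close>, the condition
  is read on \<open>1/G = 1 - y H\<close> instead. The coefficients of \<open>H\<close> are the moments of a functional \<open>\<nu>\<close>
  whose values on \<open>t\<^sup>a q\<^sup>2\<close> and \<open>t\<^sup>a (1 - 4t) q\<^sup>2\<close> are positive, because they can be written as values
  of \<open>L\<close>. The reversed polynomial of \<open>p\<close> is orthogonal to lower degrees for
  \<open>q \<mapsto> \<nu>(t\<^bsup>m-l\<^esup> q)\<close>, so it has no zero in
  \<open>[1/4, \<infinity>)\<close>.

  In particular \<open>p(0) \<noteq> 0\<close>. As \<open>p(0)\<close> is proportional to \<open>\<Sum>j. d\<^sub>j j\<^sup>2\<close>, two pairs of order at least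
  \<open>2(l + m + 1)\<close> with the same value of this sum coincide; such pairs exist because there is one
  more unknown than there are equations. All of them being proportional, they have the same order,
  so the normalized one is the optimal pair.

  For stability, the matrix acts on odd periodic sequences as \<open>lap \<circ> p(lap)\<close>. Over the complex
  numbers \<open>p(lap)\<close> is a product of factors \<open>lap - z\<close> with \<open>z \<notin> [0, 4]\<close>, each of which is bounded
  below in the supremum norm on bounded sequences (\<open>lap_resolvent_bound\<close>), with a constant that
  does not depend on \<open>N\<close>. The remaining operator \<open>lap\<close> is controlled by a maximum principle with a
  barrier adapted to the weights (\<open>lap_green_bound\<close>).
\<close>

section \<open>A positive functional and its moments\<close>

text \<open>The value at \<open>x\<close> is the mean value of \<open>p\<close> over \<open>[0, x]\<close>; integrals of polynomials are handled through
  this antiderivative.\<close>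

definition avg_poly :: "real poly \<Rightarrow> real poly" where
  "avg_poly p = (\<Sum>i\<le>degree p. monom (coeff p i / (real i + 1)) i)"

lemma coeff_avg_poly [simp]: "coeff (avg_poly p) k = coeff p k / (real k + 1)"
  by (simp add: avg_poly_def coeff_sum coeff_eq_0)

lemma avg_poly_add: "avg_poly (p + q) = avg_poly p + avg_poly q"
  by (rule poly_eqI) (simp add: add_divide_distrib)

lemma avg_poly_smult: "avg_poly (smult c p) = smult c (avg_poly p)"
  by (rule poly_eqI) simp

lemma pderiv_avg_poly: "pderiv (pCons 0 (avg_poly p)) = p"
  by (rule poly_eqI) (simp add: coeff_pderiv add.commute)

lemma avg_poly_pderiv: "pCons 0 (avg_poly (pderiv p)) = p - [:coeff p 0:]"
proof (rule poly_eqI)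
  fix n show "coeff (pCons 0 (avg_poly (pderiv p))) n = coeff (p - [:coeff p 0:]) n"
    by (cases n) (simp_all add: coeff_pderiv add.commute)
qed

lemma avg_poly_pos:
  assumes "x > 0" "p \<noteq> 0" and nonneg: "\<And>t. 0 < t \<Longrightarrow> t < x \<Longrightarrow> poly p t \<ge> 0"
  shows "poly (avg_poly p) x > 0"
proof -
  define S where "S = pCons 0 (avg_poly p)"
  have mono: "poly S a \<le> poly S b" if "0 \<le> a" "a \<le> b" "b \<le> x" for a b
  proof (cases "a < b")
    case True
    then obtain z where z: "a < z" "z < b" "poly S b - poly S a = (b - a) * poly (pderiv S) z"
      using poly_MVT by blast
    moreover have "poly (pderiv S) z \<ge> 0"
      unfolding S_def pderiv_avg_poly using z that by (intro nonneg) auto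
    ultimately show ?thesis using True by (simp add: algebra_simps)
      (smt (verit) mult_left_mono mult_right_mono)
  qed (use that in auto)
  have S0: "poly S 0 = 0" by (simp add: S_def)
  \<comment> \<open>A monotone antiderivative that starts and ends at 0 vanishes on the whole interval, so it is the
    zero polynomial.\<close>
  have "poly S x \<noteq> 0"
  proof
    assume "poly S x = 0"
    then have "poly S t = 0" if "t \<in> {0..x}" for t
      using mono[of 0 t] mono[of t x] S0 that by force
    then have "{0..x} \<subseteq> {t. poly S t = 0}" by blast
    moreover have "infinite {0..x}" using assms by simp
    ultimately have "S = 0" using poly_roots_finite finite_subset by blast
    then show False using assms pderiv_avg_poly[of p] by (simp add: S_def)
  qed
  then have "poly S x > 0" using mono[of 0 x] S0 assms by simp
  then show ?thesis using assms by (simp add: S_def zero_less_mult_iff)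
qed

text \<open>The functional \<open>p \<mapsto> \<integral>\<^sub>0\<^sup>1 \<integral>\<^sub>0\<^sup>1 p(s x (1 - x)) ds dx\<close>, that is, integration against a positive
  measure on \<open>[0, 1/4]\<close>. Its moments are \<open>2 / ((k + 1)\<^sup>2 (2k + 2 choose k + 1))\<close>, the Taylor coefficients of
  \<open>(4 / y) arcsin\<^sup>2(\<surd>y / 2)\<close>, by the Beta integral.\<close>

definition mom_fun :: "real poly \<Rightarrow> real" where
  "mom_fun p = poly (avg_poly (pcompose (avg_poly p) [:0, 1, -1:])) 1"

lemma mom_fun_add: "mom_fun (p + q) = mom_fun p + mom_fun q"
  by (simp add: mom_fun_def avg_poly_add pcompose_add)

lemma mom_fun_smult: "mom_fun (smult c p) = c * mom_fun p"
  by (simp add: mom_fun_def avg_poly_smult pcompose_smult)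

lemma mom_fun_diff: "mom_fun (p - q) = mom_fun p - mom_fun q"
  using mom_fun_add[of "p - q" q] by simp

lemma mom_fun_1: "mom_fun 1 = 1"
proof -
  have "avg_poly 1 = 1" by (rule poly_eqI) (auto simp: coeff_1)
  then show ?thesis by (simp add: mom_fun_def pcompose_1)
qed

text \<open>The point \<open>s x (1 - x)\<close> stays in \<open>[0, 1/4]\<close>, as \<open>x (1 - x) \<le> 1/4\<close>.\<close>

lemma mom_fun_pos:
  assumes "p \<noteq> 0" and nonneg: "\<And>t. 0 < t \<Longrightarrow> t < 1/4 \<Longrightarrow> poly p t \<ge> 0"
  shows "mom_fun p > 0"
proof -
  define r where "r = pcompose (avg_poly p) [:0, 1, -1:]"
  have pos: "poly r x > 0" if "0 < x" "x < 1" for x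
  proof -
    have "x * (1 - x) \<le> 1/4"
      using zero_le_power2[of "x - 1/2"] by (simp add: power2_eq_square algebra_simps)
    moreover have "x * (1 - x) > 0" using that by simp
    ultimately have "poly (avg_poly p) (x * (1 - x)) > 0"
      by (intro avg_poly_pos nonneg assms) auto
    then show ?thesis by (simp add: r_def poly_pcompose algebra_simps)
  qed
  have "r \<noteq> 0" using pos[of "1/2"] by auto
  then show ?thesis unfolding mom_fun_def r_def[symmetric]
    by (intro avg_poly_pos) (auto intro: less_imp_le pos)
qed

definition gmom :: "nat \<Rightarrow> real" where "gmom k = mom_fun (monom 1 k)"

lemma gmom_0 [simp]: "gmom 0 = 1"
  by (simp add: gmom_def mom_fun_1 monom_0 one_pCons [symmetric])

text \<open>The inner mean contributes the factor \<open>1 / (k + 1)\<close>; the integral of \<open>(x (1 - x))\<^sup>k\<close> obeys a two-term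
  recursion, obtained by integrating the derivative of \<open>(1 - 2x) (x (1 - x))\<^bsup>k+1\<^esup>\<close>, which vanishes at both
  ends.\<close>

lemma gmom_rec: "(real k + 2) * (4 * real k + 6) * gmom (Suc k) = (real k + 1)\<^sup>2 * gmom k"
proof -
  define t :: "real poly" where "t = [:0, 1, -1:]"
  define b where "b = (\<lambda>k. poly (avg_poly (t ^ k)) 1)"
  have g: "gmom k = b k / (real k + 1)" for k
  proof -
    have avg: "avg_poly (monom 1 k) = monom (1 / (real k + 1)) k"
      by (rule poly_eqI) auto
    have "pcompose ([:0, 1:] ^ n) t = t ^ n" for n
      by (induction n) (simp_all add: pcompose_1 pcompose_mult pcompose_pCons)
    then have "pcompose (monom (1 / (real k + 1)) k) t = smult (1 / (real k + 1)) (t ^ k)"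
      by (simp add: monom_altdef pcompose_smult)
    with avg show ?thesis by (simp add: gmom_def mom_fun_def t_def b_def avg_poly_smult)
  qed
  define u :: "real poly" where "u = [:1, -2:]"
  have "pderiv (u * t ^ Suc k) = smult (real k + 1) (t ^ k) - smult (4 * real k + 6) (t ^ Suc k)"
  proof -
    have "pderiv (u * t ^ Suc k) = u * (smult (real k + 1) (t ^ k) * u) + t ^ Suc k * [:-2:]"
    proof -
      have "pderiv t = u" "pderiv u = [:-2:]" by (simp_all add: u_def t_def pderiv_pCons)
      then show ?thesis
        by (simp only: pderiv_mult pderiv_power_Suc) (simp add: add.commute)
    qed
    also have "u * (smult (real k + 1) (t ^ k) * u) = smult (real k + 1) (t ^ k * (u * u))"
      by (simp add: ac_simps)
    also have "u * u = 1 - smult 4 t" by (simp add: u_def t_def one_pCons)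
    finally show ?thesis
      by (simp add: right_diff_distrib smult_diff_right smult_add_left mult.commute)
         (simp add: smult_diff_right algebra_simps flip: smult_add_left)
  qed
  moreover have "poly (avg_poly (pderiv p)) 1 = poly p 1 - poly p 0" for p
    using arg_cong[OF avg_poly_pderiv[of p], of "\<lambda>q. poly q 1"] by (simp add: poly_0_coeff_0)
  from this[of "u * t ^ Suc k"] have "poly (avg_poly (pderiv (u * t ^ Suc k))) 1 = 0"
    by (simp add: t_def)
  ultimately have "poly (avg_poly (smult (real k + 1) (t ^ k) - smult (4 * real k + 6) (t ^ Suc k))) 1 = 0"
    by simp
  moreover have "avg_poly (p - q) = avg_poly p - avg_poly q" for p q
    by (rule poly_eqI) (simp add: diff_divide_distrib)
  ultimately have "(real k + 1) * b k = (4 * real k + 6) * b (Suc k)"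
    by (simp add: avg_poly_smult b_def)
  moreover have "(real k + 2) * gmom (Suc k) = b (Suc k)" "(real k + 1) * gmom k = b k"
    using g[of k] g[of "Suc k"] by (simp_all add: field_simps)
  ultimately show ?thesis by (metis mult.assoc mult.left_commute power2_eq_square)
qed

section \<open>Pade numerators and orthogonality\<close>

text \<open>The reversal \<open>t\<^sup>m Q(1/t)\<close>, with \<open>m\<close> a prescribed bound for the degree.\<close>

definition refl_poly :: "nat \<Rightarrow> real poly \<Rightarrow> real poly" where
  "refl_poly m Q = (\<Sum>i\<le>m. monom (coeff Q i) (m - i))"

lemma coeff_refl_poly: "coeff (refl_poly m Q) k = (if k \<le> m then coeff Q (m - k) else 0)"
proof -
  have "coeff (refl_poly m Q) k = (\<Sum>i\<le>m. if i = m - k \<and> k \<le> m then coeff Q i else 0)"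
    unfolding refl_poly_def coeff_sum by (intro sum.cong) auto
  then show ?thesis by (auto simp: sum.delta)
qed

lemma degree_refl_poly: "degree (refl_poly m Q) \<le> m"
  by (rule degree_le) (simp add: coeff_refl_poly)

lemma refl_poly_eq_0_iff:
  assumes "degree Q \<le> m"
  shows "refl_poly m Q = 0 \<longleftrightarrow> Q = 0"
proof
  assume "refl_poly m Q = 0"
  then have "coeff Q i = 0" if "i \<le> m" for i
    using coeff_refl_poly[of m Q "m - i"] that by simp
  then show "Q = 0" using assms
    by (intro poly_eqI) (metis coeff_0 coeff_eq_0 le_less_linear order.strict_trans1)
qed (simp add: refl_poly_def)

lemma refl_poly_add_monom:
  assumes "degree Q \<le> m"
  shows "refl_poly (m + a) Q = monom 1 a * refl_poly m Q"
  using assms by (intro poly_eqI) (auto simp: coeff_refl_poly coeff_monom_mult coeff_eq_0)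

lemma poly_refl_poly:
  assumes "z \<noteq> 0" "degree Q \<le> m"
  shows "poly (refl_poly m Q) z = z ^ m * poly Q (1 / z)"
proof -
  have "poly Q (1 / z) = (\<Sum>i\<le>m. coeff Q i * (1 / z) ^ i)"
    unfolding poly_altdef using assms by (intro sum.mono_neutral_left) (auto simp: coeff_eq_0)
  moreover have "z ^ m * (c * (1 / z) ^ i) = c * z ^ (m - i)" if "i \<le> m" for i c
    using assms that by (simp add: power_diff field_simps)
  ultimately have "z ^ m * poly Q (1 / z) = (\<Sum>i\<le>m. coeff Q i * z ^ (m - i))"
    by (simp only: sum_distrib_left) (intro sum.cong, auto)
  then show ?thesis by (simp add: refl_poly_def poly_sum poly_monom)
qed

locale lin_functional =
  fixes M :: "real poly \<Rightarrow> real"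
  assumes M_add: "M (p + q) = M p + M q" and M_smult: "M (smult c p) = c * M p"
begin

lemma M_0 [simp]: "M 0 = 0" using M_smult[of 0 0] by simp

lemma M_diff: "M (p - q) = M p - M q"
  using M_add[of "p - q" q] by simp

lemma M_sum: "M (\<Sum>i\<in>A. f i) = (\<Sum>i\<in>A. M (f i))"
  by (induction A rule: infinite_finite_induct) (simp_all add: M_add)

lemma M_monom: "M (monom c k) = c * M (monom 1 k)"
  using M_smult[of c "monom 1 k"] by (simp add: smult_monom)

text \<open>The reversal turns the Cauchy product into the functional. Hence vanishing coefficients of a power
  series times \<open>Q\<close> beyond \<open>y\<^sup>m\<close> are orthogonality relations for the reversal of \<open>Q\<close>.\<close>

lemma moment_refl_poly:
  assumes "degree Q \<le> m"
  shows "M (monom 1 j * refl_poly m Q) = fps_nth (Abs_fps (\<lambda>k. M (monom 1 k)) * fps_of_poly Q) (m + j)"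
proof -
  have "M (monom 1 j * refl_poly m Q) = (\<Sum>i\<le>m. coeff Q i * M (monom 1 (m + j - i)))"
    unfolding refl_poly_def sum_distrib_left M_sum
    by (intro sum.cong refl) (simp add: mult_monom M_monom[of "coeff Q _"] add.commute)
  also have "\<dots> = (\<Sum>i=0..m + j. coeff Q i * M (monom 1 (m + j - i)))"
    using assms by (intro sum.mono_neutral_left) (auto simp: coeff_eq_0)
  finally show ?thesis by (simp add: fps_mult_nth mult.commute[of "Abs_fps _"])
qed

lemma orthogonal_lower_degree:
  assumes "\<And>j. j < n \<Longrightarrow> M (monom 1 j * R) = 0" "degree q < n"
  shows "M (q * R) = 0"
proof -
  have "q = (\<Sum>i\<le>degree q. smult (coeff q i) (monom 1 i))"
    by (simp add: smult_monom poly_as_sum_of_monoms)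
  then have "M (q * R) = M ((\<Sum>i\<le>degree q. smult (coeff q i) (monom 1 i)) * R)" by simp
  also have "\<dots> = 0" using assms
    by (simp add: sum_distrib_right M_sum M_smult)
  finally show ?thesis .
qed

end

interpretation mom_fun: lin_functional mom_fun
  by unfold_locales (simp_all add: mom_fun_add mom_fun_smult)

definition Gser :: "real fps" where "Gser = Abs_fps gmom"

lemma Gser_alt: "Gser = Abs_fps (\<lambda>k. mom_fun (monom 1 k))"
  by (simp add: Gser_def gmom_def [abs_def])

lemma synthetic_div_add: "synthetic_div (p + q) c = synthetic_div p c + synthetic_div (q :: real poly) c"
  by (induction p q rule: poly_induct2) simp_all

lemma synthetic_div_smult: "synthetic_div (smult a p) c = smult a (synthetic_div (p :: real poly) c)"
  by (induction p) (simp_all)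

lemma synthetic_div_sum: "synthetic_div (\<Sum>i\<in>A. f i) c = (\<Sum>i\<in>A. synthetic_div (f i :: real poly) c)"
  by (induction A rule: infinite_finite_induct) (simp_all add: synthetic_div_add)

lemma synthetic_div_monom:
  "synthetic_div (monom 1 n) z = (\<Sum>i<n. monom (z ^ (n - 1 - i)) i :: real poly)"
proof (induction n)
  case (Suc n)
  have *: "synthetic_div (monom 1 (Suc n)) z = pCons (z ^ n) (synthetic_div (monom 1 n) z)"
    by (simp add: monom_Suc poly_monom)
  have **: "pCons (z ^ n) (synthetic_div (monom 1 n) z) = monom (z ^ n) 0 + pCons 0 (\<Sum>i<n. monom (z ^ (n - 1 - i)) i)"
    by (simp add: Suc monom_0)
  have "pCons 0 (\<Sum>i\<in>A. f i) = (\<Sum>i\<in>A. pCons 0 (f i))" for A and f :: "nat \<Rightarrow> real poly"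
    by (rule poly_eqI) (simp add: coeff_sum coeff_pCons split: nat.split)
  then have "pCons 0 (\<Sum>i<n. monom (z ^ (n - 1 - i)) i) = (\<Sum>i<n. monom (z ^ (n - 1 - i)) (Suc i))"
    by (simp add: monom_Suc)
  with * ** show ?case by (simp add: sum.lessThan_Suc_shift del: sum.lessThan_Suc)
qed (simp add: monom_0)

text \<open>Both sides are the sum of \<open>q\<^sub>i g\<^sub>j z\<^bsup>l-i-j\<^esup>\<close> over \<open>i + j \<le> l\<close>: on the right by the Cauchy product, on the left
  because \<open>(t\<^sup>n - z\<^sup>n) / (t - z)\<close> is a geometric sum.\<close>

lemma numerator_formula:
  assumes "\<And>k. k \<le> l \<Longrightarrow> fps_nth (Gser * fps_of_poly Q) k = coeff P k" "degree P \<le> l" "z \<noteq> 0"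
  shows "mom_fun (synthetic_div (refl_poly (Suc l) Q) z) = z ^ l * poly P (1 / z)"
proof -
  have "mom_fun (synthetic_div (refl_poly (Suc l) Q) z)
      = (\<Sum>i\<le>Suc l. coeff Q i * mom_fun (synthetic_div (monom 1 (Suc l - i)) z))"
    unfolding refl_poly_def synthetic_div_sum mom_fun.M_sum
    by (intro sum.cong refl)
       (metis mom_fun.M_smult mult.right_neutral smult_monom synthetic_div_smult)
  also have "\<dots> = (\<Sum>i\<le>Suc l. \<Sum>j<Suc l - i. coeff Q i * gmom j * z ^ (l - (i + j)))"
    unfolding synthetic_div_monom mom_fun.M_sum mom_fun.M_monom[of "z ^ _"] gmom_def sum_distrib_left
    by (intro sum.cong refl) (auto simp: algebra_simps)
  also have "\<dots> = (\<Sum>(i, j)\<in>(SIGMA i:{..Suc l}. {..<Suc l - i}). coeff Q i * gmom j * z ^ (l - (i + j)))"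
    by (rule sum.Sigma) auto
  also have "(SIGMA i:{..Suc l}. {..<Suc l - i}) = {(i, j). i + j \<le> l}" by auto
  also have "(\<Sum>(i, j)\<in>{(i, j). i + j \<le> l}. coeff Q i * gmom j * z ^ (l - (i + j)))
     = (\<Sum>k\<le>l. \<Sum>i\<le>k. coeff Q i * gmom (k - i) * z ^ (l - (i + (k - i))))"
    by (rule sum.triangle_reindex_eq)
  also have "\<dots> = (\<Sum>k\<le>l. coeff P k * z ^ (l - k))"
  proof (intro sum.cong refl)
    fix k assume "k \<in> {..l}"
    then have "coeff P k = (\<Sum>i\<le>k. coeff Q i * gmom (k - i))"
      using assms(1)[of k, unfolded mult.commute[of Gser]]
      by (simp add: fps_mult_nth Gser_def atMost_atLeast0)
    then show "(\<Sum>i\<le>k. coeff Q i * gmom (k - i) * z ^ (l - (i + (k - i)))) = coeff P k * z ^ (l - k)"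
      by (simp add: sum_distrib_right)
  qed
  also have "\<dots> = poly (refl_poly l P) z" by (simp add: refl_poly_def poly_sum poly_monom)
  finally show ?thesis using poly_refl_poly[OF assms(3,2)] by simp
qed

lemma mom_fun_square_pos: "r \<noteq> 0 \<Longrightarrow> mom_fun (r * r) > 0"
  by (rule mom_fun_pos) auto

text \<open>With \<open>W = t\<^sup>a R\<close>, the reversal of \<open>Q\<close> at degree \<open>l + 1\<close>, \<open>numerator_formula\<close> expresses \<open>P(1/z)\<close> as
  the functional applied to \<open>(W - W(z)) / (t - z) = t\<^sup>a r + R(z) s\<close> with
  \<open>r = (R - R(z)) / (t - z)\<close> and \<open>s = (t\<^sup>a - z\<^sup>a) / (t - z)\<close>. After multiplication by \<open>R(z)\<close>, the
  orthogonality of \<open>R\<close> to \<open>r\<close> turns the first summand into the value of the functional on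
  \<open>t\<^sup>a (z - t) r\<^sup>2\<close>, which is positive because \<open>z \<ge> 1/4\<close>.\<close>

lemma pade_numerator_nonzero_if_large_degree:
  assumes PQ: "degree P \<le> l" "degree Q \<le> m" "Q \<noteq> 0"
    and contact: "\<And>k. k \<le> l + m \<Longrightarrow> fps_nth (Gser * fps_of_poly Q) k = coeff P k"
    and lm: "m \<le> l + 1" and y: "0 \<le> y" "y \<le> 4"
  shows "poly P y \<noteq> 0"
proof -
  define a where "a = l + 1 - m"
  have a: "Suc l = m + a" using lm by (simp add: a_def)
  define R where "R = refl_poly m Q"
  have R0: "R \<noteq> 0" using PQ by (simp add: R_def refl_poly_eq_0_iff)
  have orth: "mom_fun (q * (monom 1 a * R)) = 0" if "degree q < m" for q
  proof (rule mom_fun.orthogonal_lower_degree[OF _ that])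
    fix j assume "j < m"
    then have "mom_fun (monom 1 (j + a) * R) = coeff P (m + (j + a))"
      unfolding R_def mom_fun.moment_refl_poly[OF PQ(2)] Gser_alt[symmetric]
      using a by (intro contact) simp
    moreover have "coeff P (m + (j + a)) = 0" using a PQ(1) by (intro coeff_eq_0) simp
    ultimately show "mom_fun (monom 1 j * (monom 1 a * R)) = 0"
      by (simp add: mult_monom flip: mult.assoc)
  qed
  \<comment> \<open>Otherwise \<open>R\<close> would be orthogonal to itself.\<close>
  have degR: "degree R = m"
  proof (rule ccontr)
    assume "degree R \<noteq> m"
    then have "mom_fun (R * (monom 1 a * R)) = 0"
      using degree_refl_poly[of m Q] by (intro orth) (simp add: R_def)
    moreover have "mom_fun (R * (monom 1 a * R)) > 0"
      unfolding mult.left_commute[of R] using R0 by (intro mom_fun_pos) (auto simp: poly_monom)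
    ultimately show False by simp
  qed
  show ?thesis
  proof (cases "y = 0")
    case True
    have "coeff P 0 = coeff Q 0"
      using contact[of 0] by (simp add: Gser_def)
    also have "\<dots> = coeff R m" by (simp add: R_def coeff_refl_poly)
    also have "\<dots> \<noteq> 0" using degR R0 by auto
    finally show ?thesis using True by (simp add: poly_0_coeff_0)
  next
    case False
    define z where "z = 1 / y"
    have z: "z \<ge> 1/4" "z \<noteq> 0" "y = 1 / z" using y False by (auto simp: z_def field_simps)
    define r where "r = synthetic_div R z"
    define s where "s = synthetic_div (monom 1 a) z"
    have Rr: "R = [:-z, 1:] * r + [:poly R z:]"
      using synthetic_div_correct'[of z R] by (simp add: r_def)
    have s: "[:-z, 1:] * s + [:z ^ a:] = monom 1 a"
      using synthetic_div_correct'[of z "monom 1 a"] by (simp add: s_def poly_monom)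
    define W where "W = monom 1 a * R"
    have "[:-z, 1:] * synthetic_div W z = [:-z, 1:] * (monom 1 a * r + smult (poly R z) s)"
    proof -
      have "[:-z, 1:] * synthetic_div W z = W - [:poly W z:]"
        using synthetic_div_correct'[of z W] by (simp add: algebra_simps)
      also have "\<dots> = monom 1 a * ([:-z, 1:] * r) + smult (poly R z) (monom 1 a - [:z ^ a:])"
        unfolding W_def by (subst Rr) (simp add: poly_monom algebra_simps smult_diff_right)
      also have "monom 1 a - [:z ^ a:] = [:-z, 1:] * s"
        by (subst s[symmetric]) simp
      finally show ?thesis by (simp only: algebra_simps mult_smult_right mult_smult_left)
    qed
    then have sdW: "synthetic_div W z = monom 1 a * r + smult (poly R z) s"
      by (simp only: mult_cancel_left) simp
    have "z ^ l * poly P y = mom_fun (synthetic_div W z)"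
      using numerator_formula[of l Q P z] contact PQ z
      by (simp add: W_def R_def a refl_poly_add_monom)
    then have val: "z ^ l * poly P y * poly R z
        = mom_fun (monom 1 a * r) * poly R z + (poly R z)\<^sup>2 * mom_fun s"
      by (simp add: sdW mom_fun_add mom_fun_smult power2_eq_square algebra_simps)
    have Rz: "[:poly R z:] = R - [:-z, 1:] * r" using Rr by (simp only: algebra_simps) 
    have "smult (poly R z) (monom 1 a * r) = monom 1 a * r * [:poly R z:]" by simp
    also have "\<dots> = monom 1 a * r * (R - [:-z, 1:] * r)" by (simp only: Rz)
    also have "\<dots> = r * (monom 1 a * R) + monom 1 a * [:z, -1:] * r * r"
    proof -
      have "[:z, -1:] = - [:-z, 1:]" by simp
      then show ?thesis by (simp only: algebra_simps)
    qed
    \<comment> \<open>The constant \<open>R(z)\<close> is \<open>R - (t - z) r\<close>.\<close>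
    finally have part1: "mom_fun (monom 1 a * r) * poly R z
        = mom_fun (r * (monom 1 a * R)) + mom_fun (monom 1 a * [:z, -1:] * r * r)"
      by (metis mom_fun_add mom_fun_smult mult.commute)
    have s_nonneg: "poly s t \<ge> 0" if "0 < t" "t < 1/4" for t
    proof -
      have "(z - t) * poly s t = z ^ a - t ^ a"
        using arg_cong[OF s, of "\<lambda>p. poly p t"] by (simp add: poly_monom algebra_simps)
      moreover have "t ^ a \<le> z ^ a" using that z by (intro power_mono) auto
      ultimately show ?thesis using that z by (smt (verit) mult_pos_neg)
    qed
    have s_ge: "mom_fun s \<ge> 0"
      using mom_fun_pos[OF _ s_nonneg] by (cases "s = 0") (auto intro: less_imp_le)
    have "z ^ l * poly P y * poly R z > 0"
    proof (cases "r = 0")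
      case True
      then have "degree R = 0" by (simp add: r_def synthetic_div_eq_0_iff)
      then have "m = 0" using degR by simp
      then have "a \<noteq> 0" using a by simp
      then have "s \<noteq> 0" by (auto simp: s_def synthetic_div_eq_0_iff degree_monom_eq)
      then have "mom_fun s > 0" using mom_fun_pos s_nonneg by blast
      moreover have "poly R z \<noteq> 0" using Rr True R0 by auto
      ultimately show ?thesis using True by (simp add: val)
    next
      case False
      then have "degree R \<noteq> 0" by (simp add: r_def synthetic_div_eq_0_iff)
      then have "degree r < m" using degR by (simp add: r_def degree_synthetic_div)
      then have "mom_fun (r * (monom 1 a * R)) = 0" by (rule orth)
      moreover have "mom_fun (monom 1 a * [:z, -1:] * r * r) > 0"
        using False z by (intro mom_fun_pos) (auto simp: poly_monom mult.assoc simp del: mult_pCons_left mult_pCons_right)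
      ultimately show ?thesis using part1 s_ge by (simp add: val add_pos_nonneg)
    qed
    then show ?thesis by auto
  qed
qed

section \<open>The reciprocal series\<close>

text \<open>This linear map transports the functional \<open>nu\<close> of the reciprocal series, defined next, back to
  \<open>mom_fun\<close>. It sends \<open>t\<^sup>k\<close> to the polynomial part of \<open>t\<^sup>k / G(1/t)\<close>, a monic polynomial of degree
  \<open>k\<close>.\<close>

definition hat :: "real poly \<Rightarrow> real poly" where
  "hat p = fold_coeffs (\<lambda>c p. pCons (c - mom_fun (pCons 0 p)) p) p 0"

lemma hat_0 [simp]: "hat 0 = 0"
  by (simp add: hat_def)

text \<open>The functional whose moments are the coefficients of \<open>H\<close> in \<open>1/G = 1 - y H\<close>.\<close>

definition nu :: "real poly \<Rightarrow> real" where
  "nu p = mom_fun (pCons 0 (hat p))"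

lemma hat_rec: "hat (pCons c p) = pCons (c - nu p) (hat p)"
proof (cases "p = 0 \<and> c = 0")
  case True
  then show ?thesis by (simp add: nu_def)
next
  case False
  then show ?thesis unfolding nu_def hat_def
    by (cases "p = 0") (simp_all add: fold_coeffs_pCons_not_0_0_eq fold_coeffs_pCons_coeff_not_0_eq)
qed

lemma nu_0 [simp]: "nu 0 = 0" by (simp add: nu_def)

lemma nu_eq_of_hat: "nu p = mom_fun ([:0, 1:] * hat p)" by (simp add: nu_def)

lemma hat_add: "hat (p + q) = hat p + hat q"
proof (induction p q rule: poly_induct2)
  case (pCons a p b q)
  then have "nu (p + q) = nu p + nu q"
    using mom_fun_add[of "pCons 0 (hat p)" "pCons 0 (hat q)"] by (simp add: nu_def)
  then show ?case using pCons by (simp add: hat_rec)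
qed simp

lemma hat_smult: "hat (smult c p) = smult c (hat p)"
proof (induction p)
  case (pCons a p)
  then have "nu (smult c p) = c * nu p"
    using mom_fun_smult[of c "pCons 0 (hat p)"] by (simp add: nu_def)
  then show ?case using pCons by (simp add: hat_rec right_diff_distrib)
qed simp

lemma hat_eq_0_iff: "hat p = 0 \<longleftrightarrow> p = 0"
  by (induction p) (auto simp: hat_rec)

interpretation nu: lin_functional nu
proof
  fix p q c
  show "nu (p + q) = nu p + nu q" 
    by (simp add: nu_eq_of_hat hat_add distrib_left mom_fun_add del: mult_pCons_left)
  show "nu (smult c p) = c * nu p"
    by (simp add: nu_eq_of_hat hat_smult mom_fun_smult del: mult_pCons_left)
qed

lemma mom_fun_const: "mom_fun [:c:] = c"
  using mom_fun_smult[of c 1] mom_fun_1 by (simp add: one_pCons)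

lemma hat_times_X: "hat ([:0, 1:] * p) = [:0, 1:] * hat p - [:nu p:]"
  by (simp add: hat_rec)

text \<open>This identity is the reason for introducing \<open>hat\<close>. It reflects that the divided difference of
  \<open>1/G\<close> is that of \<open>G\<close> divided by the values of \<open>G\<close> at the two points. Formally, the right-hand side does not
  change when a factor \<open>t\<close> is moved from \<open>p\<close> to \<open>q\<close>, which drives the induction.\<close>

lemma nu_mult: "nu (p * q) = mom_fun ([:0, 1:] * hat p * hat q)"
proof (induction p arbitrary: q)
  case (pCons c p)
  let ?X = "[:0, 1:] :: real poly"
  have "nu (pCons c p * q) = nu (smult c q + p * (?X * q))"
    by (simp add: mult_pCons_left)
  also have "\<dots> = c * nu q + mom_fun (?X * hat p * hat (?X * q))"
    by (simp only: nu.M_add nu.M_smult pCons.IH)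
  also have "?X * hat p * hat (?X * q) = ?X * hat p * (?X * hat q) - smult (nu q) (?X * hat p)"
    by (simp only: hat_times_X right_diff_distrib) simp
  also have "mom_fun \<dots> = mom_fun (?X * hat p * (?X * hat q)) - nu q * nu p"
    by (simp only: mom_fun_diff mom_fun_smult nu_eq_of_hat)
  finally have l: "nu (pCons c p * q) = c * nu q + mom_fun (?X * hat p * (?X * hat q)) - nu q * nu p"
    by simp
  have "hat (pCons c p) = ?X * hat p + [:c - nu p:]" by (simp add: hat_rec)
  then have "?X * hat (pCons c p) * hat q = ?X * hat p * (?X * hat q) + smult (c - nu p) (?X * hat q)"
    by (simp only: distrib_left distrib_right ac_simps) simp
  then have "mom_fun (?X * hat (pCons c p) * hat q)
      = mom_fun (?X * hat p * (?X * hat q)) + (c - nu p) * nu q"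
    by (simp only: mom_fun_add mom_fun_smult nu_eq_of_hat)
  with l show ?case by (simp add: algebra_simps)
qed simp

definition Hser :: "real fps" where "Hser = Abs_fps (\<lambda>k. nu (monom 1 k))"

text \<open>Unfolding the recursion of \<open>hat\<close> along the powers of \<open>t\<close> gives the coefficients of \<open>G = 1 + y H G\<close>.\<close>

lemma gmom_conv: "gmom (Suc k) = (\<Sum>i\<le>k. nu (monom 1 i) * gmom (k - i))"
proof -
  let ?X = "[:0, 1:] :: real poly"
  have gen: "gmom (Suc (j + k)) = mom_fun (?X * monom 1 j * hat (monom 1 k))
      + (\<Sum>i<k. nu (monom 1 i) * gmom (j + k - i))" for j
  proof (induction k arbitrary: j)
    case 0
    have "hat (monom 1 0) = 1" by (simp add: monom_0 hat_rec one_pCons)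
    moreover have "?X * monom 1 j = monom 1 (Suc j)" by (simp add: monom_Suc)
    ultimately show ?case by (simp only: gmom_def) simp
  next
    case (Suc k)
    have "hat (monom 1 (Suc k)) = ?X * hat (monom 1 k) - [:nu (monom 1 k):]"
      by (simp add: monom_Suc hat_rec)
    then have "?X * monom 1 j * hat (monom 1 (Suc k)) =
        ?X * monom 1 (Suc j) * hat (monom 1 k) - smult (nu (monom 1 k)) (monom 1 (Suc j))"
      by (simp add: monom_Suc right_diff_distrib) 
    then have "mom_fun (?X * monom 1 j * hat (monom 1 (Suc k))) =
        mom_fun (?X * monom 1 (Suc j) * hat (monom 1 k)) - nu (monom 1 k) * gmom (Suc j)"
      by (simp only: mom_fun_diff mom_fun_smult gmom_def)
    with Suc[of "Suc j"] show ?case by simp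
  qed
  show ?thesis using gen[of 0] by (simp add: monom_0 one_pCons[symmetric] nu_eq_of_hat)
     (simp add: nu_eq_of_hat sum.lessThan_Suc flip: lessThan_Suc_atMost)
qed

lemma Gser_Hser: "Gser * (1 - fps_X * Hser) = 1"
proof -
  have HG: "fps_nth (Hser * Gser) k = gmom (Suc k)" for k
    by (simp add: fps_mult_nth Hser_def Gser_def gmom_conv atMost_atLeast0)
  have "Gser = 1 + fps_X * (Hser * Gser)"
  proof (rule fps_ext)
    fix n show "fps_nth Gser n = fps_nth (1 + fps_X * (Hser * Gser)) n"
      by (cases n) (simp_all add: HG, simp_all add: Gser_def)
  qed
  then show ?thesis by (simp add: algebra_simps)
qed

text \<open>With \<open>u = t hat r\<close>, \<open>\<kappa> = nu r\<close> and \<open>v = u - \<kappa>\<close>, the values of \<open>nu\<close> on \<open>r\<^sup>2\<close>, \<open>t r\<^sup>2\<close>, \<open>t\<^sup>2 r\<^sup>2\<close> are those of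
  \<open>mom_fun\<close> on \<open>t (hat r)\<^sup>2\<close>, \<open>v\<^sup>2\<close>, \<open>t v\<^sup>2\<close>. Combining them and using
  that \<open>\<kappa>\<close> is the value of \<open>mom_fun\<close> on \<open>u\<close>, one gets the values of \<open>nu\<close> on \<open>(1 - 4t) r\<^sup>2\<close> and \<open>t (1 - 4t) r\<^sup>2\<close>:
  they are those of \<open>mom_fun\<close> on \<open>t (1 - 4t) (hat r)\<^sup>2\<close>, plus \<open>4 \<kappa>\<^sup>2\<close>, and on \<open>(1 - 4t) v\<^sup>2\<close>.\<close>

lemma nu_square_pos:
  assumes "r \<noteq> 0"
  defines "X \<equiv> [:0, 1:] :: real poly"
  shows "nu (r * r) > 0" "nu (X * r * r) > 0"
    "nu ((1 - smult 4 X) * r * r) > 0" "nu (X * (1 - smult 4 X) * r * r) > 0"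
proof -
  define u where "u = X * hat r"
  define v where "v = u - [:nu r:]"
  have h: "hat r \<noteq> 0" using assms by (simp add: hat_eq_0_iff)
  have "degree u \<noteq> 0" using h by (simp add: u_def X_def)
  then have v: "v \<noteq> 0" by (auto simp: v_def)
  have Lu: "mom_fun u = nu r" by (simp add: u_def X_def nu_def)
  have hX: "hat (X * r) = v" using hat_times_X[of r] by (simp add: v_def u_def X_def)
  have e0: "nu (r * r) = mom_fun (X * hat r * hat r)"
    by (simp only: nu_mult X_def)
  have "nu (X * r * r) = mom_fun (X * v * hat r)"
    by (simp only: nu_mult hX[symmetric]) (simp only: X_def)
  also have "X * v * hat r = v * v + smult (nu r) v"
  proof -
    have "X * v * hat r = v * u" by (simp only: u_def ac_simps)
    also have "u = v + [:nu r:]" by (simp add: v_def)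
    finally show ?thesis by (simp add: distrib_left)
  qed
  also have "mom_fun \<dots> = mom_fun (v * v)"
    using Lu by (simp add: mom_fun_add mom_fun_smult v_def mom_fun_diff mom_fun_const)
  finally have e1: "nu (X * r * r) = mom_fun (v * v)" .
  have e2: "nu (X * X * r * r) = mom_fun (X * v * v)"
  proof -
    have "nu ((X * r) * (X * r)) = mom_fun (X * v * v)"
      by (simp only: nu_mult hX) (simp only: X_def)
    then show ?thesis by (simp only: ac_simps)
  qed
  show "nu (r * r) > 0"
    unfolding e0 using h by (intro mom_fun_pos) (auto simp: X_def mult.assoc simp del: mult_pCons_left mult_pCons_right)
  show "nu (X * r * r) > 0"
    unfolding e1 using v by (rule mom_fun_square_pos)
  have "nu (X * (1 - smult 4 X) * r * r) = nu (X * r * r) - 4 * nu (X * X * r * r)"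
    by (simp add: algebra_simps flip: nu.M_smult nu.M_diff)
  also have "\<dots> = mom_fun ((1 - smult 4 X) * (v * v))"
  proof -
    have "(1 - smult 4 X) * (v * v) = v * v - smult 4 (X * v * v)"
      by (simp add: left_diff_distrib mult.assoc)
    then show ?thesis by (simp only: e1 e2 mom_fun_diff mom_fun_smult)
  qed
  also have "\<dots> > 0"
    using v by (intro mom_fun_pos) (auto simp: X_def one_pCons simp del: mult_pCons_left mult_pCons_right)
  finally show "nu (X * (1 - smult 4 X) * r * r) > 0" .
  have "nu ((1 - smult 4 X) * r * r) = nu (r * r) - 4 * nu (X * r * r)"
    by (simp add: algebra_simps flip: nu.M_smult nu.M_diff)
  also have "\<dots> = mom_fun (X * hat r * hat r - smult 4 (v * v))"
    by (simp add: e0 e1 mom_fun_diff mom_fun_smult)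
  also have "X * hat r * hat r - smult 4 (v * v)
      = X * (1 - smult 4 X) * (hat r * hat r) + smult (4 * nu r) u
        + smult (4 * nu r) u - [:4 * (nu r)\<^sup>2:]"
  proof -
    have "v * v = u * u - smult (nu r) u - smult (nu r) u + [:(nu r)\<^sup>2:]"
      by (simp add: v_def algebra_simps power2_eq_square)
    moreover have "X * (1 - smult 4 X) * (hat r * hat r) = X * hat r * hat r - smult 4 (u * u)"
      by (simp add: u_def algebra_simps)
    ultimately show ?thesis by (simp add: smult_diff_right smult_add_right)
  qed
  also have "mom_fun \<dots> = mom_fun (X * (1 - smult 4 X) * (hat r * hat r)) + 4 * (nu r)\<^sup>2"
    by (simp only: mom_fun_add mom_fun_diff mom_fun_smult mom_fun_const Lu power2_eq_square)
  finally have "nu ((1 - smult 4 X) * r * r) = mom_fun (X * (1 - smult 4 X) * (hat r * hat r)) + 4 * (nu r)\<^sup>2" .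
  moreover have "mom_fun (X * (1 - smult 4 X) * (hat r * hat r)) > 0"
    using h by (intro mom_fun_pos) (auto simp: X_def one_pCons simp del: mult_pCons_left mult_pCons_right)
  ultimately show "nu ((1 - smult 4 X) * r * r) > 0" by (simp add: add_pos_nonneg)
qed

text \<open>Half of the power \<open>t\<^sup>a\<close> is absorbed into the square, and \<open>z - t\<close> is a nonnegative constant plus
  a positive multiple of \<open>1 - 4t\<close>.\<close>

lemma nu_weighted_square_pos:
  assumes "q \<noteq> 0" "z \<ge> 1/4"
  shows "nu (monom 1 a * (q * q)) > 0" "nu (monom 1 a * [:z, -1:] * (q * q)) > 0"
proof -
  let ?X = "[:0, 1:] :: real poly"
  define r where "r = monom 1 (a div 2) * q"
  have r: "r \<noteq> 0" using assms by (simp add: r_def)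
  have split: "monom 1 a * (q * q) = (if even a then r * r else ?X * (r * r))"
  proof -
    have "monom 1 a = (if even a then 1 else ?X) * (monom 1 (a div 2) * monom 1 (a div 2))"
      by (auto simp: mult_monom one_pCons monom_0 simp flip: monom_Suc elim!: evenE oddE)
         (simp_all add: monom_Suc mult_2)
    then show ?thesis by (auto simp: r_def mult.assoc mult.left_commute)
  qed
  show pos: "nu (monom 1 a * (q * q)) > 0"
    using nu_square_pos(1,2)[OF r] by (simp add: split mult.assoc del: mult_pCons_left)
  have "nu ((1 - smult 4 ?X) * (monom 1 a * (q * q))) > 0"
    using nu_square_pos(3,4)[OF r]
    by (simp add: split mult.assoc mult.left_commute[of ?X] del: mult_pCons_left)
  moreover have "[:z, -1:] = smult (1/4) (1 - smult 4 ?X) + [:z - 1/4:]"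
    by (simp add: one_pCons)
  then have "monom 1 a * [:z, -1:] * (q * q)
     = smult (1/4) ((1 - smult 4 ?X) * (monom 1 a * (q * q))) + smult (z - 1/4) (monom 1 a * (q * q))"
    by (simp only: distrib_left distrib_right) (simp add: ac_simps del: mult_pCons_left)
  then have "nu (monom 1 a * [:z, -1:] * (q * q))
     = 1/4 * nu ((1 - smult 4 ?X) * (monom 1 a * (q * q))) + (z - 1/4) * nu (monom 1 a * (q * q))"
    by (simp only: nu.M_add nu.M_smult)
  ultimately show "nu (monom 1 a * [:z, -1:] * (q * q)) > 0"
    using pos assms by (simp add: add_pos_nonneg)
qed

text \<open>Dividing the contact condition by \<open>G\<close> exchanges the roles of \<open>P\<close> and \<open>Q\<close>: the reversal \<open>R\<close> of \<open>P\<close> is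
  orthogonal to lower degrees for \<open>q \<mapsto> nu (t\<^sup>a q)\<close>. A zero \<open>z \<ge> 1/4\<close> of \<open>R = (t - z) q\<close> would give
  \<open>nu (t\<^sup>a (z - t) q\<^sup>2) = 0\<close>, and a zero of \<open>P\<close> at 0 lowers the degree of \<open>R\<close>, which makes it orthogonal
  to itself.\<close>

lemma pade_numerator_nonzero_if_small_degree:
  assumes PQ: "degree P \<le> l" "degree Q \<le> m" "P \<noteq> 0"
    and contact: "\<And>k. k \<le> l + m \<Longrightarrow> fps_nth (Gser * fps_of_poly Q) k = coeff P k"
    and lm: "l \<le> m" and y: "0 \<le> y" "y \<le> 4"
  shows "poly P y \<noteq> 0"
proof
  assume Py: "poly P y = 0"
  define a where "a = m - l"
  have a: "m = l + a" using lm by (simp add: a_def)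
  define R where "R = refl_poly l P"
  have R0: "R \<noteq> 0" using PQ by (simp add: R_def refl_poly_eq_0_iff)
  have contact': "fps_nth ((1 - fps_X * Hser) * fps_of_poly P) k = coeff Q k" if "k \<le> l + m" for k
  proof -
    have "fps_of_poly Q = (1 - fps_X * Hser) * (Gser * fps_of_poly Q)"
      using Gser_Hser by (simp flip: mult.assoc) (simp add: mult.commute)
    then have "coeff Q k = fps_nth ((1 - fps_X * Hser) * (Gser * fps_of_poly Q)) k"
      by (metis fps_of_poly_nth)
    also have "\<dots> = (\<Sum>i=0..k. fps_nth (1 - fps_X * Hser) i * fps_nth (Gser * fps_of_poly Q) (k - i))"
      by (rule fps_mult_nth)
    also have "\<dots> = (\<Sum>i=0..k. fps_nth (1 - fps_X * Hser) i * fps_nth (fps_of_poly P) (k - i))"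
      using that by (intro sum.cong refl) (simp add: contact)
    finally show ?thesis by (simp add: fps_mult_nth)
  qed
  have orth: "nu (q * (monom 1 a * R)) = 0" if "degree q < l" for q
  proof (rule nu.orthogonal_lower_degree[OF _ that])
    fix j assume j: "j < l"
    have "nu (monom 1 (j + a) * R) = fps_nth (Hser * fps_of_poly P) (l + (j + a))"
      unfolding R_def nu.moment_refl_poly[OF PQ(1)] Hser_def ..
    also have "\<dots> = coeff P (Suc (m + j)) - coeff Q (Suc (m + j))"
    proof -
      have "(1 - fps_X * Hser) * fps_of_poly P = fps_of_poly P - fps_X * (Hser * fps_of_poly P)"
        by (simp add: left_diff_distrib mult.assoc)
      moreover have idx: "l + (j + a) = m + j" using a by simp
      ultimately show ?thesis unfolding idx using contact'[of "Suc (m + j)"] j by simp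
    qed
    also have "\<dots> = 0" using PQ lm by (simp add: coeff_eq_0)
    finally show "nu (monom 1 j * (monom 1 a * R)) = 0"
      by (simp add: mult_monom flip: mult.assoc)
  qed
  show False
  proof (cases "y = 0")
    case True
    then have "coeff R l = 0" using Py by (simp add: R_def coeff_refl_poly poly_0_coeff_0)
    moreover have "degree R \<le> l" by (simp add: R_def degree_refl_poly)
    ultimately have "degree R < l" using R0 by (metis leading_coeff_0_iff order_le_imp_less_or_eq)
    then have "nu (R * (monom 1 a * R)) = 0" by (rule orth)
    then show False using nu_weighted_square_pos(1)[OF R0, of "1/4" a]
      by (simp add: mult.left_commute)
  next
    case False
    define z where "z = 1 / y"
    have z: "z \<ge> 1/4" "z \<noteq> 0" "y = 1 / z" using y False by (auto simp: z_def field_simps)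
    have "poly R z = 0" using poly_refl_poly[of z P l] z PQ Py by (simp add: R_def)
    then obtain q where q: "R = [:-z, 1:] * q" by (auto simp: poly_eq_0_iff_dvd)
    have q0: "q \<noteq> 0" using R0 q by auto
    then have "degree R = Suc (degree q)" by (subst q, subst degree_mult_eq) auto
    then have "degree q < l" using degree_refl_poly[of l P] by (simp add: R_def)
    then have "nu (q * (monom 1 a * R)) = 0" by (rule orth)
    moreover have "q * (monom 1 a * R) = - (monom 1 a * [:z, -1:] * (q * q))"
    proof -
      have "[:-z, 1:] = - [:z, -1:]" by simp
      then show ?thesis unfolding q by (simp only: ac_simps mult_minus_left mult_minus_right)
    qed
    ultimately show False using nu_weighted_square_pos(2)[OF q0 z(1), of a] nu.M_diff[of 0]
      by simp
  qed
qed

theorem pade_numerator_nonzero: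
  assumes "degree P \<le> l" "degree Q \<le> m" "P \<noteq> 0 \<or> Q \<noteq> 0"
    and contact: "\<And>k. k \<le> l + m \<Longrightarrow> fps_nth (Gser * fps_of_poly Q) k = coeff P k"
    and "0 \<le> y" "y \<le> 4"
  shows "poly P y \<noteq> 0"
proof (cases "m \<le> l + 1")
  case True
  have "Q \<noteq> 0"
  proof
    assume "Q = 0"
    then have "coeff P k = 0" if "k \<le> l" for k using contact[of k] that by simp
    then have "P = 0" using assms(1) by (intro poly_eqI) (metis coeff_0 coeff_eq_0 le_less_linear order.strict_trans1)
    then show False using assms \<open>Q = 0\<close> by simp
  qed
  then show ?thesis using pade_numerator_nonzero_if_large_degree[OF assms(1,2) _ contact True] assms by blast
next
  case False
  have "P \<noteq> 0"
  proof
    assume "P = 0"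
    have "Gser \<noteq> 0" using Gser_Hser by auto
    have "Q \<noteq> 0" using assms \<open>P = 0\<close> by simp
    define n where "n = subdegree (Gser * fps_of_poly Q)"
    have nz: "Gser * fps_of_poly Q \<noteq> 0" using \<open>Gser \<noteq> 0\<close> \<open>Q \<noteq> 0\<close> by simp
    have "subdegree Gser = 0" by (rule subdegreeI) (simp_all add: Gser_def)
    then have "n = subdegree (fps_of_poly Q)" using \<open>Gser \<noteq> 0\<close> \<open>Q \<noteq> 0\<close> by (simp add: n_def)
    then have "coeff Q n \<noteq> 0" using \<open>Q \<noteq> 0\<close>
      by (metis fps_of_poly_0 fps_of_poly_eq_iff fps_of_poly_nth nth_subdegree_nonzero)
    then have "n \<le> m" using assms(2) le_degree order.trans by blast
    then have "fps_nth (Gser * fps_of_poly Q) n = 0" using contact[of n] \<open>P = 0\<close> by simp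
    then show False using nz n_def by (simp add: nth_subdegree_nonzero)
  qed
  then show ?thesis using pade_numerator_nonzero_if_small_degree[OF assms(1,2) _ contact] False assms by simp
qed

section \<open>Symbols of symmetric sequences\<close>


text \<open>The moments are real, so the real and the imaginary parts of the coefficients satisfy the same
  conditions separately.\<close>

lemma pade_numerator_nonzero_complex:
  fixes P Q :: "complex poly"
  assumes "degree P \<le> l" "degree Q \<le> m" "P \<noteq> 0 \<or> Q \<noteq> 0"
    and contact: "\<And>k. k \<le> l + m \<Longrightarrow> (\<Sum>i=0..k. of_real (gmom i) * coeff Q (k - i)) = coeff P k"
    and y: "0 \<le> y" "y \<le> 4"
  shows "poly P (of_real y) \<noteq> 0"
proof -
  have Re: "Re (poly p (of_real y)) = poly (map_poly Re p) y" for p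
    by (induction p) (simp_all add: map_poly_pCons)
  have Im: "Im (poly p (of_real y)) = poly (map_poly Im p) y" for p
    by (induction p) (simp_all add: map_poly_pCons)
  have deg: "degree (map_poly Re p) \<le> degree p" "degree (map_poly Im p) \<le> degree p"
    for p :: "complex poly"
    by (auto intro!: degree_le simp: coeff_map_poly coeff_eq_0)
  have eqI: "p = 0" if "map_poly Re p = 0" "map_poly Im p = 0" for p
  proof (rule poly_eqI)
    fix n
    have "Re (coeff p n) = 0" "Im (coeff p n) = 0"
      using arg_cong[OF that(1), of "\<lambda>p. coeff p n"] arg_cong[OF that(2), of "\<lambda>p. coeff p n"]
      by (simp_all add: coeff_map_poly)
    then show "coeff p n = coeff 0 n" by (simp add: complex_eq_iff)
  qed
  have cRe: "fps_nth (Gser * fps_of_poly (map_poly Re Q)) k = coeff (map_poly Re P) k" if "k \<le> l + m" for k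
    using arg_cong[OF contact[OF that], of Re] by (simp add: coeff_map_poly fps_mult_nth Gser_def)
  have cIm: "fps_nth (Gser * fps_of_poly (map_poly Im Q)) k = coeff (map_poly Im P) k" if "k \<le> l + m" for k
    using arg_cong[OF contact[OF that], of Im] by (simp add: coeff_map_poly fps_mult_nth Gser_def)
  have "(map_poly Re P \<noteq> 0 \<or> map_poly Re Q \<noteq> 0) \<or> (map_poly Im P \<noteq> 0 \<or> map_poly Im Q \<noteq> 0)"
    using assms(3) eqI by blast
  then show ?thesis
  proof
    assume "map_poly Re P \<noteq> 0 \<or> map_poly Re Q \<noteq> 0"
    then have "poly (map_poly Re P) y \<noteq> 0"
      using pade_numerator_nonzero[of "map_poly Re P" l "map_poly Re Q" m y] cRe y
        deg(1)[of P] deg(1)[of Q] assms(1,2) by auto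
    then show ?thesis using Re[of P] by auto
  next
    assume "map_poly Im P \<noteq> 0 \<or> map_poly Im Q \<noteq> 0"
    then have "poly (map_poly Im P) y \<noteq> 0"
      using pade_numerator_nonzero[of "map_poly Im P" l "map_poly Im Q" m y] cIm y
        deg(2)[of P] deg(2)[of Q] assms(1,2) by auto
    then show ?thesis using Im[of P] by auto
  qed
qed

definition lap :: "(int \<Rightarrow> complex) \<Rightarrow> int \<Rightarrow> complex" where
  "lap w i = 2 * w i - w (i - 1) - w (i + 1)"

definition poly_op :: "complex poly \<Rightarrow> (int \<Rightarrow> complex) \<Rightarrow> int \<Rightarrow> complex" where
  "poly_op p w = fold_coeffs (\<lambda>c f i. c * w i + lap f i) p (\<lambda>_. 0)"

lemma poly_op_0 [simp]: "poly_op 0 w = (\<lambda>_. 0)"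
  by (simp add: poly_op_def)

lemma poly_op_pCons [simp]: "poly_op (pCons c p) w = (\<lambda>i. c * w i + lap (poly_op p w) i)"
proof (cases "p = 0 \<and> c = 0")
  case True
  then show ?thesis by (simp add: lap_def)
next
  case False
  then show ?thesis unfolding poly_op_def
    by (cases "p = 0") simp_all
qed

lemma lap_add: "lap (\<lambda>i. u i + v i) i = lap u i + lap v i"
  and lap_cmult: "lap (\<lambda>i. c * u i) i = c * lap u i"
  by (simp_all add: lap_def algebra_simps)

lemma poly_op_add: "poly_op (p + q) w i = poly_op p w i + poly_op q w i"
proof -
  have "poly_op (p + q) w = (\<lambda>i. poly_op p w i + poly_op q w i)"
    by (induction p q rule: poly_induct2) (auto intro!: ext simp: lap_add algebra_simps)
  then show ?thesis by simp
qed

lemma poly_op_smult: "poly_op (smult c p) w i = c * poly_op p w i"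
proof -
  have "poly_op (smult c p) w = (\<lambda>i. c * poly_op p w i)"
    by (induction p) (auto intro!: ext simp: lap_cmult algebra_simps)
  then show ?thesis by simp
qed

lemma poly_op_diff: "poly_op (p - q) w i = poly_op p w i - poly_op q w i"
  using poly_op_add[of "p - q" q w i] by simp

lemma poly_op_sum: "poly_op (\<Sum>j\<in>A. f j) w i = (\<Sum>j\<in>A. poly_op (f j) w i)"
  by (induction A rule: infinite_finite_induct) (simp_all add: poly_op_add)

lemma poly_op_mult: "poly_op (p * q) w = poly_op p (poly_op q w)"
  by (induction p) (auto intro!: ext simp: poly_op_add poly_op_smult)

text \<open>The polynomial that expresses \<open>S\<^sup>n + S\<^bsup>-n\<^esup>\<close> in terms of \<open>2 - S - S\<^bsup>-1\<^esup>\<close>, both for the shift \<open>S\<close> of sequences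
  (\<open>poly_op_cheb\<close>) and for \<open>S = e\<^sup>X\<close> (\<open>cheb_compose\<close>); up to the affine change of variable, twice a Chebyshev
  polynomial.\<close>

fun cheb :: "nat \<Rightarrow> complex poly" where
  "cheb 0 = [:2:]"
| "cheb (Suc 0) = [:2, -1:]"
| "cheb (Suc (Suc n)) = [:2, -1:] * cheb (Suc n) - cheb n"

lemma degree_cheb: "degree (cheb n) \<le> n"
proof (induction n rule: cheb.induct)
  case (3 n)
  have "degree ([:2, -1:] * cheb (Suc n)) \<le> 1 + Suc n"
    using degree_mult_le[of "[:2, -1:]" "cheb (Suc n)"] 3(1) by simp
  then show ?case using 3(2) by (simp add: degree_diff_le del: mult_pCons_left)
qed simp_all

lemma poly_op_cheb: "poly_op (cheb n) w i = w (i - int n) + w (i + int n)"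
proof (induction n arbitrary: i rule: cheb.induct)
  case (3 n)
  have lin: "poly_op [:2, -1:] u j = u (j - 1) + u (j + 1)" for u j
    by (simp add: lap_def)
  show ?case unfolding cheb.simps poly_op_diff poly_op_mult lin 3 by (simp add: algebra_simps)
qed (simp_all add: lap_def)

definition lap_exp :: "complex fps" where
  "lap_exp = 2 - fps_exp 1 - fps_exp (-1)"

lemma lap_exp_nth_0 [simp]: "fps_nth lap_exp 0 = 0" by (simp add: lap_exp_def)

lemma linear_poly_compose_lap_exp: "fps_of_poly [:2, -1 :: complex:] oo lap_exp = fps_exp 1 + fps_exp (-1)"
proof -
  have "fps_of_poly [:2, -1 :: complex:] = fps_const 2 - fps_X"
    by (rule fps_ext) (auto simp: coeff_pCons split: nat.split)
  also have "\<dots> oo lap_exp = fps_const 2 - lap_exp" by (simp add: fps_compose_sub_distrib)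
  finally show ?thesis by (simp add: lap_exp_def numeral_fps_const)
qed

lemma cheb_compose: "fps_of_poly (cheb n) oo lap_exp = fps_exp (of_nat n) + fps_exp (- of_nat n)"
proof (induction n rule: cheb.induct)
  case 1
  have "(2 :: complex fps) oo lap_exp = 2" by (metis fps_const_compose numeral_fps_const)
  then show ?case by simp
next
  case 2
  show ?case by (simp add: linear_poly_compose_lap_exp)
next
  case (3 n)
  have "fps_of_poly (cheb (Suc (Suc n))) oo lap_exp
     = (fps_exp 1 + fps_exp (-1)) * (fps_exp (of_nat (Suc n)) + fps_exp (- of_nat (Suc n)))
       - (fps_exp (of_nat n) + fps_exp (- of_nat n))"
    unfolding cheb.simps fps_of_poly_diff fps_of_poly_mult fps_compose_sub_distrib
      fps_compose_mult_distrib[OF lap_exp_nth_0] linear_poly_compose_lap_exp 3 ..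
  then show ?case
    by (simp add: distrib_left distrib_right add_ac flip: fps_exp_add_mult)
qed

definition symbol :: "(int \<Rightarrow> complex) \<Rightarrow> nat \<Rightarrow> complex poly" where
  "symbol d n = [:d 0:] + (\<Sum>j=1..n. smult (d (int j)) (cheb j))"

lemma degree_symbol: "degree (symbol d n) \<le> n"
  unfolding symbol_def
  by (intro degree_add_le degree_sum_le) (auto intro: order.trans[OF degree_smult_le] order.trans[OF degree_cheb])

lemma sym_sum:
  fixes e :: "int \<Rightarrow> complex"
  assumes "d \<in> sym_seqs" and supp: "\<And>j. j > int n \<Longrightarrow> d j = 0"
  shows "(\<Sum>j | d j \<noteq> 0. d j * e j) = d 0 * e 0 + (\<Sum>j=1..n. d (int j) * (e (- int j) + e (int j)))"
proof -
  have sym: "d (- j) = d j" for j using assms by (simp add: sym_seqs_def)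
  have d0: "d j = 0" if "\<bar>j\<bar> > int n" for j
    using supp[of "\<bar>j\<bar>"] sym[of j] that by (cases "j \<ge> 0") auto
  have "(\<Sum>j | d j \<noteq> 0. d j * e j) = (\<Sum>j\<in>{-int n..int n}. d j * e j)"
  proof (intro sum.mono_neutral_left)
    show "{j. d j \<noteq> 0} \<subseteq> {-int n..int n}"
    proof
      fix j assume "j \<in> {j. d j \<noteq> 0}"
      then have "\<not> \<bar>j\<bar> > int n" using d0 by blast
      then show "j \<in> {-int n..int n}" by auto
    qed
  qed auto
  also have "{-int n..int n} = insert 0 ((\<lambda>j. - int j) ` {1..n} \<union> int ` {1..n})"
  proof (intro equalityI subsetI)
    fix j assume j: "j \<in> {-int n..int n}"
    have "j = 0 \<or> (j > 0 \<and> j = int (nat j) \<and> nat j \<in> {1..n}) \<or> (j < 0 \<and> j = - int (nat (-j)) \<and> nat (-j) \<in> {1..n})"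
      using j by auto
    then show "j \<in> insert 0 ((\<lambda>j. - int j) ` {1..n} \<union> int ` {1..n})" by blast
  qed auto
  also have "(\<Sum>j\<in>\<dots>. d j * e j) = d 0 * e 0 + (\<Sum>j\<in>(\<lambda>j. - int j) ` {1..n} \<union> int ` {1..n}. d j * e j)"
    by (rule sum.insert) auto
  also have "(\<Sum>j\<in>(\<lambda>j. - int j) ` {1..n} \<union> int ` {1..n}. d j * e j)
     = (\<Sum>j\<in>(\<lambda>j. - int j) ` {1..n}. d j * e j) + (\<Sum>j\<in>int ` {1..n}. d j * e j)"
    by (rule sum.union_disjoint) auto
  also have "\<dots> = (\<Sum>j=1..n. d (int j) * (e (- int j) + e (int j)))"
    by (simp add: sum.reindex inj_on_def sym distrib_left sum.distrib)
  finally show ?thesis .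
qed

lemma conv_op_eq_poly_op:
  assumes "d \<in> sym_seqs" "\<And>j. j > int n \<Longrightarrow> d j = 0"
  shows "conv_op d w = poly_op (symbol d n) w"
proof
  fix i
  have "conv_op d w i = d 0 * w (i - 0) + (\<Sum>j=1..n. d (int j) * (w (i - (- int j)) + w (i - int j)))"
    unfolding conv_op_def by (rule sym_sum[OF assms])
  then show "conv_op d w i = poly_op (symbol d n) w i"
    by (simp add: symbol_def poly_op_add poly_op_sum poly_op_smult poly_op_cheb lap_def add.commute)
qed

text \<open>Convolution with \<open>d\<close> maps the unit sequence to \<open>d\<close>.\<close>

lemma symbol_eq_0_imp:
  assumes "d \<in> sym_seqs" "\<And>j. j > int n \<Longrightarrow> d j = 0" "symbol d n = 0"
  shows "d = (\<lambda>_. 0)"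
proof
  fix i
  have "conv_op d (\<lambda>k. if k = 0 then 1 else 0) i = 0"
    using conv_op_eq_poly_op[OF assms(1,2)] assms(3) by simp
  moreover have "conv_op d (\<lambda>k. if k = 0 then 1 else 0) i = (\<Sum>j | d j \<noteq> 0. if j = i then d j else 0)"
    unfolding conv_op_def by (intro sum.cong) auto
  ultimately show "d i = 0" using assms(1) by (auto simp: sym_seqs_def sum.delta split: if_splits)
qed

definition seq_moment :: "(int \<Rightarrow> complex) \<Rightarrow> nat \<Rightarrow> complex" where
  "seq_moment d k = (\<Sum>j | d j \<noteq> 0. d j * of_int j ^ k)"

lemma symbol_compose_nth:
  assumes "d \<in> sym_seqs" "\<And>j. j > int n \<Longrightarrow> d j = 0"
  shows "fps_nth (fps_of_poly (symbol d n) oo lap_exp) k = seq_moment d k / fact k"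
proof -
  have "fps_of_poly (symbol d n) oo lap_exp
     = fps_const (d 0) + (\<Sum>j=1..n. fps_const (d (int j)) * (fps_exp (of_nat j) + fps_exp (- of_nat j)))"
    unfolding symbol_def
    by (simp add: fps_of_poly_add fps_of_poly_const fps_of_poly_sum fps_of_poly_smult
       fps_compose_add_distrib fps_compose_sum_distrib fps_compose_mult_distrib cheb_compose)
  moreover have "seq_moment d k = d 0 * of_int 0 ^ k
     + (\<Sum>j=1..n. d (int j) * (of_int (- int j) ^ k + of_int (int j) ^ k))"
    unfolding seq_moment_def by (rule sym_sum[OF assms])
  ultimately show ?thesis
    by (cases "k = 0")
       (simp_all add: fps_sum_nth sum_divide_distrib power_0_left ac_simps add_divide_distrib distrib_left)
qed

section \<open>Order conditions as Pade contact\<close>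

text \<open>A complex copy of \<open>Gser\<close>, to be combined with complex sequences.\<close>

definition Gc :: "complex fps" where "Gc = Abs_fps (\<lambda>k. of_real (gmom k))"

text \<open>The recursion of the moments as a differential equation for \<open>F(y) = y G(y)\<close>, namely
  \<open>y (4 - y) F'' + (2 - y) F' = 2\<close>.\<close>

lemma gmom_ode:
  defines "F \<equiv> fps_X * Gc"
  shows "fps_deriv (fps_deriv F) * (fps_X * (fps_X - 4)) + fps_deriv F * (fps_X - 2) = - 2"
proof (rule fps_ext)
  fix n
  have rec: "(of_nat k + 2) * (4 * of_nat k + 6) * complex_of_real (gmom (Suc k)) = (of_nat k + 1)\<^sup>2 * of_real (gmom k)" for k
    using arg_cong[OF gmom_rec[of k], of complex_of_real] by simp
  have F: "fps_nth F 0 = 0" "fps_nth F (Suc k) = of_real (gmom k)" for k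
    by (simp_all add: F_def Gc_def)
  have F': "fps_nth (fps_deriv F) k = of_nat (Suc k) * of_real (gmom k)" for k
    by (simp add: F)
  have F'': "fps_nth (fps_deriv (fps_deriv F)) k = of_nat (Suc k) * (of_nat (Suc (Suc k)) * of_real (gmom (Suc k)))" for k
    by (simp add: F del: of_nat_Suc)
  let ?A = "fps_deriv (fps_deriv F)" and ?B = "fps_deriv F"
  have e: "?A * (fps_X * (fps_X - 4)) + ?B * (fps_X - 2)
      = fps_X * (fps_X * ?A) - fps_const 4 * (fps_X * ?A) + fps_X * ?B - fps_const 2 * ?B"
    by (simp add: algebra_simps numeral_fps_const)
  show "fps_nth (?A * (fps_X * (fps_X - 4)) + ?B * (fps_X - 2)) n = fps_nth (- 2) n"
  proof (cases n)
    case 0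
    then show ?thesis unfolding e using F'[of 0] by (simp add: numeral_fps_const)
  next
    case (Suc k)
    show ?thesis
    proof (cases k)
      case 0
      then show ?thesis unfolding e Suc using F'[of 0] F'[of 1] F''[of 0] rec[of 0]
        by (simp add: numeral_fps_const F field_simps)
    next
      case (Suc j)
      have "of_nat (Suc j) * (of_nat (Suc (Suc j)) * of_real (gmom (Suc j))) 
          - 4 * (of_nat (Suc (Suc j)) * (of_nat (Suc (Suc (Suc j))) * of_real (gmom (Suc (Suc j)))))
          + of_nat (Suc (Suc j)) * of_real (gmom (Suc j))
          - 2 * (of_nat (Suc (Suc (Suc j))) * complex_of_real (gmom (Suc (Suc j)))) = 0"
        using rec[of "Suc j"] by (simp add: algebra_simps power2_eq_square)
      then show ?thesis unfolding e \<open>n = Suc k\<close> Suc using F'[of "Suc j"] F'[of "Suc (Suc j)"] F''[of j] F''[of "Suc j"]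
        by (simp add: numeral_fps_const del: fps_deriv_nth of_nat_Suc)
    qed
  qed
qed

text \<open>Since \<open>(y')\<^sup>2 = y (y - 4)\<close> and \<open>y'' = y - 2\<close> for \<open>y = 2 - 2 cosh X\<close>, the differential equation says that the second
  derivative of \<open>F(y(X))\<close> is \<open>-2\<close>.\<close>

lemma X_times_Gc_compose_lap_exp: "(fps_X * Gc) oo lap_exp = - (fps_X\<^sup>2)"
proof -
  define F where "F = fps_X * Gc"
  define \<Phi> where "\<Phi> = F oo lap_exp"
  define E where "E = fps_exp (1 :: complex)"
  define E' where "E' = fps_exp (- 1 :: complex)"
  have EE: "E * E' = 1" by (simp add: E_def E'_def flip: fps_exp_add_mult)
  have Y: "lap_exp = 2 - E - E'" by (simp add: lap_exp_def E_def E'_def)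
  have m1: "fps_const (- 1 :: complex) = - 1" by (simp flip: fps_const_neg)
  have Y': "fps_deriv lap_exp = E' - E" by (simp add: Y E_def E'_def m1)
  have Y'': "fps_deriv (fps_deriv lap_exp) = lap_exp - 2" unfolding Y' by (simp add: Y E_def E'_def m1)
  have "(fps_deriv lap_exp)\<^sup>2 = lap_exp * (lap_exp - 4)"
  proof -
    have "(fps_deriv lap_exp)\<^sup>2 - lap_exp * (lap_exp - 4) = 4 * (1 - E * E')"
      by (subst Y') (simp add: Y algebra_simps power2_eq_square)
    then show ?thesis by (simp add: EE)
  qed
  note Ysq = this
  have d1: "fps_deriv \<Phi> = (fps_deriv F oo lap_exp) * fps_deriv lap_exp"
    unfolding \<Phi>_def by (rule fps_compose_deriv) simp
  have "fps_deriv (fps_deriv \<Phi>) = (fps_deriv (fps_deriv F) oo lap_exp) * (fps_deriv lap_exp)\<^sup>2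
      + (fps_deriv F oo lap_exp) * fps_deriv (fps_deriv lap_exp)"
    unfolding d1 by (simp add: fps_compose_deriv power2_eq_square algebra_simps)
  also have "\<dots> = (fps_deriv (fps_deriv F) * (fps_X * (fps_X - 4)) + fps_deriv F * (fps_X - 2)) oo lap_exp"
    unfolding Ysq Y'' 
    by (simp add: fps_compose_add_distrib fps_compose_mult_distrib fps_compose_sub_distrib numeral_fps_const)
  also have "\<dots> = (- 2) oo lap_exp" unfolding F_def gmom_ode ..
  also have "\<dots> = - 2" by (simp add: fps_compose_uminus numeral_fps_const)
  finally have d2: "fps_deriv (fps_deriv \<Phi>) = - 2" .
  show ?thesis
  proof (rule fps_ext)
    fix n
    have p0: "fps_nth \<Phi> 0 = 0" by (simp add: \<Phi>_def F_def)
    have "fps_nth (fps_deriv \<Phi>) 0 = 0" unfolding d1 by (simp add: Y' E_def E'_def)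
    then have p1: "fps_nth \<Phi> (Suc 0) = 0" by simp
    have p2: "of_nat (Suc k) * (of_nat (Suc (Suc k)) * fps_nth \<Phi> (Suc (Suc k))) = fps_nth (- 2) k" for k
      using arg_cong[OF d2, of "\<lambda>f. fps_nth f k"] by (simp del: of_nat_Suc)
    show "fps_nth ((fps_X * Gc) oo lap_exp) n = fps_nth (- (fps_X\<^sup>2)) n"
    proof (cases n)
      case 0 then show ?thesis using p0 by (simp add: \<Phi>_def F_def)
    next
      case n: (Suc k)
      show ?thesis
      proof (cases k)
        case 0 then show ?thesis using p1 n by (simp add: \<Phi>_def F_def)
      next
        case (Suc j)
        have "fps_nth \<Phi> (Suc (Suc j)) = (if j = 0 then -1 else 0)"
        proof (cases "j = 0")
          case True
          have "fps_nth (- 2 :: complex fps) 0 = - 2" by (simp add: numeral_fps_const)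
          then show ?thesis using p2[of 0] True by simp
        next
          case False
          then show ?thesis using p2[of j] by (simp add: numeral_fps_const del: of_nat_Suc)
        qed
        then show ?thesis using n Suc by (simp add: \<Phi>_def F_def fps_X_power_nth)
      qed
    qed
  qed
qed

lemma lap_exp_power_nth:
  "k < 2 * i \<Longrightarrow> fps_nth (lap_exp ^ i) k = 0" "fps_nth (lap_exp ^ i) (2 * i) = (- 1) ^ i"
proof -
  define Y2 where "Y2 = fps_shift 2 lap_exp"
  have low: "fps_nth lap_exp k = 0" if "k < 2" for k
    using that by (cases "k = 0") (auto simp: lap_exp_def less_2_cases_iff numeral_fps_const)
  have Y: "lap_exp = fps_X ^ 2 * Y2"
  proof (rule fps_ext)
    fix n show "fps_nth lap_exp n = fps_nth (fps_X ^ 2 * Y2) n"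
    proof (cases "n < 2")
      case False
      then have "n - 2 + 2 = n" by simp
      then show ?thesis using False by (simp add: fps_X_power_mult_nth Y2_def del: add_2_eq_Suc')
    qed (simp add: fps_X_power_mult_nth low)
  qed
  have "fps_nth Y2 0 = - 1" by (simp add: Y2_def lap_exp_def numeral_fps_const)
  moreover have P: "lap_exp ^ i = fps_X ^ (2 * i) * Y2 ^ i"
    by (simp add: Y power_mult_distrib power_mult)
  ultimately show "fps_nth (lap_exp ^ i) (2 * i) = (- 1) ^ i"
    by (simp add: fps_X_power_mult_nth fps_nth_power_0)
  show "k < 2 * i \<Longrightarrow> fps_nth (lap_exp ^ i) k = 0" by (simp add: P fps_X_power_mult_nth)
qed

text \<open>The series \<open>lap_exp\<close> starts with \<open>- X\<^sup>2\<close>, so substituting it doubles the order of vanishing.\<close>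

lemma contact_of_compose:
  assumes "\<And>n. n < 2 * K \<Longrightarrow> fps_nth (A oo lap_exp) n = 0" "k < K"
  shows "fps_nth A k = 0"
  using assms(2)
proof (induction k rule: less_induct)
  case (less k)
  have "0 = fps_nth (A oo lap_exp) (2 * k)" using assms(1) less.prems by simp
  also have "\<dots> = (\<Sum>i=0..2 * k. fps_nth A i * fps_nth (lap_exp ^ i) (2 * k))"
    by (simp add: fps_compose_nth)
  also have "\<dots> = (\<Sum>i=0..2 * k. if i = k then fps_nth A k * (- 1) ^ k else 0)"
  proof (intro sum.cong refl)
    fix i
    consider "i < k" | "i = k" | "i > k" by linarith
    then show "fps_nth A i * fps_nth (lap_exp ^ i) (2 * k) = (if i = k then fps_nth A k * (- 1) ^ k else 0)"
      by cases (use less in \<open>auto simp: lap_exp_power_nth\<close>)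
  qed
  also have "\<dots> = fps_nth A k * (- 1) ^ k" by (simp add: sum.delta)
  finally show ?case by simp
qed

text \<open>The result of applying the formula at \<open>h = 1\<close> to \<open>x\<^sup>k\<close>. For \<open>k < 2\<close> the truncated exponent \<open>k - 2\<close> is harmless
  because its factor vanishes.\<close>

definition defect :: "(int \<Rightarrow> complex) \<Rightarrow> (int \<Rightarrow> complex) \<Rightarrow> nat \<Rightarrow> complex" where
  "defect d s k = seq_moment d k + of_nat (k * (k - 1)) * seq_moment s (k - 2)"

lemma odd_moment:
  assumes "d \<in> sym_seqs" "odd k"
  shows "seq_moment d k = 0"
proof -
  have "seq_moment d k = (\<Sum>j | d j \<noteq> 0. d j * of_int (- j) ^ k)"
    unfolding seq_moment_def
    by (rule sum.reindex_bij_witness[of _ uminus uminus]) (use assms in \<open>auto simp: sym_seqs_def\<close>)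
  also have "\<dots> = - seq_moment d k" using assms by (simp add: seq_moment_def sum_negf)
  finally show ?thesis by simp
qed

text \<open>The generating function \<open>\<Sum>k. defect d s k X\<^sup>k / k!\<close> equals \<open>P(y) + X\<^sup>2 Q(y) = (P - F Q)(y)\<close> at
  \<open>y = 2 - 2 cosh X\<close>, with \<open>P\<close> and \<open>Q\<close> the symbols of \<open>d\<close> and \<open>s\<close>. Its vanishing to order \<open>2(l + m + 2)\<close> is therefore
  a Pade contact condition.\<close>

lemma symbol_factor:
  fixes d s :: "int \<Rightarrow> complex"
  assumes d: "d \<in> sym_seqs" "\<And>j. j > int (l + 1) \<Longrightarrow> d j = 0"
    and s: "s \<in> sym_seqs" "\<And>j. j > int m \<Longrightarrow> s j = 0"
    and defect: "\<And>k. k \<le> l + m + 1 \<Longrightarrow> defect d s (2 * k) = 0"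
    and nz: "(d, s) \<noteq> (\<lambda>_. 0, \<lambda>_. 0)"
  obtains P where "symbol d (l + 1) = pCons 0 P" "coeff P 0 = - seq_moment d 2 / 2"
    "\<And>y. 0 \<le> y \<Longrightarrow> y \<le> 4 \<Longrightarrow> poly P (of_real y) \<noteq> 0"
proof -
  define PP where "PP = symbol d (l + 1)"
  define Q where "Q = symbol s m"
  define A where "A = fps_of_poly PP - (fps_X * Gc) * fps_of_poly Q"
  have degs: "degree PP \<le> l + 1" "degree Q \<le> m" unfolding PP_def Q_def by (rule degree_symbol)+
  \<comment> \<open>Odd powers of \<open>X\<close> are absent by symmetry.\<close>
  have A0: "fps_nth (A oo lap_exp) n = 0" if n: "n < 2 * (l + m + 2)" for n
  proof -
    have "A oo lap_exp = (fps_of_poly PP oo lap_exp) + fps_X\<^sup>2 * (fps_of_poly Q oo lap_exp)"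
      unfolding A_def by (simp add: fps_compose_sub_distrib fps_compose_mult_distrib[OF lap_exp_nth_0, of "fps_X * Gc"] X_times_Gc_compose_lap_exp)
    then have "fps_nth (A oo lap_exp) n = seq_moment d n / fact n
        + (if n < 2 then 0 else seq_moment s (n - 2) / fact (n - 2))"
      by (simp add: PP_def Q_def symbol_compose_nth[OF d] symbol_compose_nth[OF s] fps_X_power_mult_nth)
    also have "\<dots> = defect d s n / fact n"
    proof (cases "n < 2")
      case True then show ?thesis by (auto simp: defect_def less_2_cases_iff)
    next
      case False
      then obtain k where k: "n = Suc (Suc k)" by (metis add_2_eq_Suc le_Suc_ex not_less)
      have "(fact n :: complex) = of_nat (n * (n - 1)) * fact (n - 2)" by (simp add: k algebra_simps)
      moreover have "of_nat (n * (n - 1)) \<noteq> (0 :: complex)" unfolding of_nat_eq_0_iff by (simp add: k)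
      ultimately show ?thesis using False by (simp add: defect_def add_divide_distrib del: of_nat_mult)
    qed
    also have "defect d s n = 0"
    proof (cases "even n")
      case True then show ?thesis using defect n by (auto elim!: evenE)
    next
      case False
      then show ?thesis using odd_moment[OF d(1)] odd_moment[OF s(1), of "n - 2"]
        by (cases "n = 1") (auto simp: defect_def)
    qed
    finally show ?thesis by simp
  qed
  have A: "fps_nth A k = 0" if "k < l + m + 2" for k
    using contact_of_compose[of "l + m + 2" A] A0 that by blast
  have "coeff PP 0 = 0" using A[of 0] by (simp add: A_def)
  then obtain P where P: "PP = pCons 0 P" by (cases PP) auto
  have degP: "degree P \<le> l" using degs P by (cases "P = 0") auto
  have contact: "(\<Sum>i=0..k. of_real (gmom i) * coeff Q (k - i)) = coeff P k" if "k \<le> l + m" for k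
    using A[of "Suc k"] that by (simp add: A_def P Gc_def mult.assoc) (simp add: fps_mult_nth)
  have "P \<noteq> 0 \<or> Q \<noteq> 0"
  proof (rule ccontr)
    assume "\<not> (P \<noteq> 0 \<or> Q \<noteq> 0)"
    then have "symbol d (l + 1) = 0" "symbol s m = 0" using P by (simp_all add: PP_def Q_def)
    then have "d = (\<lambda>_. 0)" "s = (\<lambda>_. 0)"
      using symbol_eq_0_imp[OF d] symbol_eq_0_imp[OF s] by blast+
    then show False using nz by simp
  qed
  then have "poly P (of_real y) \<noteq> 0" if "0 \<le> y" "y \<le> 4" for y
    by (rule pade_numerator_nonzero_complex[OF degP degs(2)]) (use contact that in auto)
  moreover have "coeff P 0 = - seq_moment d 2 / 2"
  proof -
    have "seq_moment d 2 / fact 2 = (\<Sum>i=0..2. coeff PP i * fps_nth (lap_exp ^ i) 2)"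
      using symbol_compose_nth[OF d(1), of "l + 1" 2] d(2) by (simp add: fps_compose_nth PP_def)
    also have "\<dots> = - coeff PP 1"
      using lap_exp_power_nth(2)[of 1] lap_exp_power_nth(1)[of 2 2] by (simp add: numeral_2_eq_2)
    finally show ?thesis by (simp add: P)
  qed
  ultimately show ?thesis using P that unfolding PP_def by blast
qed

section \<open>Taylor expansion and consistency\<close>

text \<open>Induction on the order: the derivative of the remainder of \<open>U 0\<close> is the remainder, one order lower, of
  \<open>U 1\<close>, and the mean value inequality gains one power of \<open>x\<close>.\<close>

lemma taylor_bound:
  fixes U :: "nat \<Rightarrow> real \<Rightarrow> complex"
  assumes "\<And>k x. (U k has_vector_derivative U (Suc k) x) (at x)"
  shows "\<exists>C\<ge>0. \<forall>x\<in>{-1..1}. norm (U 0 x - (\<Sum>k<n. of_real (x ^ k / fact k) * U k 0)) \<le> C * \<bar>x\<bar> ^ n"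
  using assms
proof (induction n arbitrary: U)
  case 0
  have "continuous_on {-1..1} (U 0)"
    using 0 by (meson has_vector_derivative_continuous continuous_at_imp_continuous_on)
  then have "bounded (U 0 ` {-1..1})"
    by (intro compact_imp_bounded compact_continuous_image) auto
  then obtain C where "\<forall>y\<in>U 0 ` {-1..1}. norm y \<le> C" "C > 0"
    unfolding bounded_pos by blast
  then show ?case by (intro exI[of _ C]) auto
next
  case (Suc n)
  obtain C where C: "C \<ge> 0" "\<And>x. x \<in> {-1..1} \<Longrightarrow>
      norm (U (Suc 0) x - (\<Sum>k<n. of_real (x ^ k / fact k) * U (Suc k) 0)) \<le> C * \<bar>x\<bar> ^ n"
    using Suc.IH[of "\<lambda>k. U (Suc k)"] Suc.prems by blast
  define R where "R = (\<lambda>x. U 0 x - (\<Sum>k<Suc n. of_real (x ^ k / fact k) * U k 0))"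
  define R' where "R' = (\<lambda>x. U (Suc 0) x - (\<Sum>k<n. of_real (x ^ k / fact k) * U (Suc k) 0))"
  have der: "(R has_vector_derivative R' x) (at x)" for x
  proof -
    have pw: "((\<lambda>x. of_real (x ^ Suc k / fact (Suc k)) * U (Suc k) 0) has_vector_derivative
        of_real (x ^ k / fact k) * U (Suc k) 0) (at x)" for k
    proof -
      have "((\<lambda>x. x ^ Suc k / fact (Suc k)) has_real_derivative
          (real (Suc k) * x ^ k) / fact (Suc k)) (at x)"
        by (rule derivative_eq_intros refl | simp)+
      also have "(real (Suc k) * x ^ k) / fact (Suc k) = x ^ k / fact k"
        by (simp add: divide_simps)
      finally show ?thesis
        by (intro has_vector_derivative_mult_left has_vector_derivative_of_real)
           (simp add: has_real_derivative_iff_has_vector_derivative)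
    qed
    have "R = (\<lambda>x. U 0 x - (U 0 0 + (\<Sum>k<n. of_real (x ^ Suc k / fact (Suc k)) * U (Suc k) 0)))"
      by (rule ext) (simp add: R_def sum.lessThan_Suc_shift del: sum.lessThan_Suc fact_Suc)
    moreover have "((\<lambda>x. U 0 x - (U 0 0 + (\<Sum>k<n. of_real (x ^ Suc k / fact (Suc k)) * U (Suc k) 0)))
        has_vector_derivative (U (Suc 0) x - (0 + (\<Sum>k<n. of_real (x ^ k / fact k) * U (Suc k) 0)))) (at x)"
      by (intro has_vector_derivative_diff has_vector_derivative_add has_vector_derivative_const
          has_vector_derivative_sum Suc.prems pw)
    ultimately show ?thesis by (simp add: R'_def)
  qed
  have "norm (R x) \<le> C * \<bar>x\<bar> ^ Suc n" if x: "x \<in> {-1..1}" for x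
  proof -
    have "norm (R x - R 0) \<le> (C * \<bar>x\<bar> ^ n) * norm (x - 0)"
    proof (rule differentiable_bound[where S = "{-\<bar>x\<bar>..\<bar>x\<bar>}" and f' = "\<lambda>x h. h *\<^sub>R R' x"])
      fix t assume t: "t \<in> {-\<bar>x\<bar>..\<bar>x\<bar>}"
      show "(R has_derivative (\<lambda>h. h *\<^sub>R R' t)) (at t within {-\<bar>x\<bar>..\<bar>x\<bar>})"
        using der[of t] has_derivative_at_withinI unfolding has_vector_derivative_def by blast
      have "norm (R' t) \<le> C * \<bar>t\<bar> ^ n" unfolding R'_def using t x by (intro C) auto
      also have "\<dots> \<le> C * \<bar>x\<bar> ^ n" using t C(1) by (intro mult_left_mono power_mono) auto
      finally show "onorm (\<lambda>h. h *\<^sub>R R' t) \<le> C * \<bar>x\<bar> ^ n"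
        by (intro onorm_le) (simp add: mult.commute mult_left_mono)
    qed auto
    moreover have "R 0 = 0" by (simp add: R_def sum.lessThan_Suc_shift del: sum.lessThan_Suc)
    ultimately show ?thesis by (simp add: mult.assoc mult.commute[of "\<bar>x\<bar>"])
  qed
  then show ?case using C(1) unfolding R_def by blast
qed

lemma smooth_deriv:
  assumes "smooth u"
  shows "(D_iter k u has_vector_derivative D_iter (Suc k) u x) (at x)"
  using assms vector_derivative_works[of "D_iter k u" "at x"]
  by (simp add: smooth_def D_iter_def)

lemma smooth_poly:
  "D_iter k (\<lambda>x. of_real (poly p x)) = (\<lambda>x. of_real (poly ((pderiv ^^ k) p) x))"
  "smooth (\<lambda>x. of_real (poly p x))"
proof -
  have der: "((\<lambda>x. complex_of_real (poly q x)) has_vector_derivative of_real (poly (pderiv q) x)) (at x)" for q x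
    by (intro has_vector_derivative_of_real) (simp add: has_real_derivative_iff_has_vector_derivative[symmetric] poly_DERIV)
  show *: "D_iter k (\<lambda>x. of_real (poly p x)) = (\<lambda>x. of_real (poly ((pderiv ^^ k) p) x))" for k
    by (induction k) (use der in \<open>auto simp: D_iter_def vector_derivative_at\<close>)
  show "smooth (\<lambda>x. of_real (poly p x))"
    unfolding smooth_def * using der differentiableI_vector by blast
qed

lemma taylor_bigo:
  assumes "smooth u"
  shows "(\<lambda>h. D_iter i u (of_int j * h) - (\<Sum>k<n. of_real ((of_int j * h) ^ k / fact k) * D_iter (i + k) u 0))
     \<in> O[at_right 0](\<lambda>h. of_real (h ^ n))"
proof -
  obtain C where C: "C \<ge> 0" "\<And>x. x \<in> {-1..1} \<Longrightarrow>
      norm (D_iter i u x - (\<Sum>k<n. of_real (x ^ k / fact k) * D_iter (i + k) u 0)) \<le> C * \<bar>x\<bar> ^ n"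
    using taylor_bound[of "\<lambda>k. D_iter (i + k) u" n] smooth_deriv[OF assms] by auto
  have "eventually (\<lambda>h. h \<in> {0<..<1 / (\<bar>of_int j\<bar> + 1)}) (at_right (0::real))"
    by (rule eventually_at_right_real) (simp add: add_nonneg_pos)
  then show ?thesis
  proof (intro bigoI[of _ "C * \<bar>of_int j\<bar> ^ n"], eventually_elim)
    case (elim h)
    then have "\<bar>of_int j * h\<bar> \<le> 1"
      by (auto simp: abs_mult field_simps)
    then have "of_int j * h \<in> {-1..1}" by auto
    from C(2)[OF this] show ?case using elim
      by (simp add: abs_mult power_mult_distrib norm_power mult.assoc)
  qed
qed

text \<open>Replacing \<open>u\<close> and its second derivative by their Taylor polynomials leaves a combination of the
  defects, and the remainders are of the required order.\<close>

lemma consistentI: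
  assumes d: "d \<in> sym_seqs" and s: "s \<in> sym_seqs"
    and defect: "\<And>k. k < n + 2 \<Longrightarrow> defect d s k = 0"
  shows "consistent n d s"
  unfolding consistent_def
proof (intro allI impI)
  fix u assume u: "smooth u"
  define J where "J = {j. d j \<noteq> 0 \<or> s j \<noteq> 0}"
  define U where "U = (\<lambda>k. D_iter k u 0)"
  have fin: "finite J"
    using d s unfolding J_def sym_seqs_def Collect_disj_eq by simp
  define R where "R = (\<lambda>j h. u (of_int j * h) - (\<Sum>k<n + 2. of_real ((of_int j * h) ^ k / fact k) * U k))"
  define R2 where "R2 = (\<lambda>j h. D_iter 2 u (of_int j * h) - (\<Sum>k<n. of_real ((of_int j * h) ^ k / fact k) * U (2 + k)))"
  have R: "R j \<in> O[at_right 0](\<lambda>h. of_real (h ^ (n + 2)))" for j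
    using taylor_bigo[OF u, of 0 j "n + 2"] by (simp add: R_def U_def D_iter_def)
  have R2: "R2 j \<in> O[at_right 0](\<lambda>h. of_real (h ^ n))" for j
    using taylor_bigo[OF u, of 2 j n] by (simp add: R2_def U_def)
  have mom: "seq_moment d k = (\<Sum>j\<in>J. d j * of_int j ^ k)" "seq_moment s k = (\<Sum>j\<in>J. s j * of_int j ^ k)" for k
    unfolding seq_moment_def by (rule sum.mono_neutral_left; use fin in \<open>auto simp: J_def\<close>)+
  \<comment> \<open>The Taylor polynomials contribute \<open>\<Sum>k. h\<^sup>k U\<^sub>k defect d s k / k!\<close>.\<close>
  have main: "(\<Sum>j\<in>J. d j * (\<Sum>k<n + 2. of_real ((of_int j * h) ^ k / fact k) * U k)
      + of_real (h ^ 2) * s j * (\<Sum>k<n. of_real ((of_int j * h) ^ k / fact k) * U (2 + k))) = 0" for h :: real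
  proof -
    have shift: "of_real (h ^ 2) * (\<Sum>k<n. of_real ((of_int j * h) ^ k / fact k) * U (2 + k))
        = (\<Sum>k<n + 2. of_real (h ^ k / fact k) * U k * (of_nat (k * (k - 1)) * of_int j ^ (k - 2)))" for j :: int
    proof -
      have "(\<Sum>k<n + 2. of_real (h ^ k / fact k) * U k * (of_nat (k * (k - 1)) * of_int j ^ (k - 2)))
        = (\<Sum>k<n. of_real (h ^ (k + 2) / fact (k + 2)) * U (2 + k) * (of_nat ((k + 2) * (k + 1)) * of_int j ^ k))"
        by (simp add: sum.lessThan_Suc_shift numeral_2_eq_2 del: sum.lessThan_Suc fact_Suc of_nat_mult)
      also have "\<dots> = (\<Sum>k<n. of_real (h ^ 2) * (of_real ((of_int j * h) ^ k / fact k) * U (2 + k)))"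
      proof (intro sum.cong refl)
        fix k
        have "(fact (k + 2) :: complex) = of_nat ((k + 2) * (k + 1)) * fact k" by (simp add: algebra_simps)
        moreover have "of_nat ((k + 2) * (k + 1)) \<noteq> (0::complex)" unfolding of_nat_eq_0_iff by simp
        ultimately show "of_real (h ^ (k + 2) / fact (k + 2)) * U (2 + k) * (of_nat ((k + 2) * (k + 1)) * of_int j ^ k)
           = of_real (h ^ 2) * (of_real ((of_int j * h) ^ k / fact k) * U (2 + k))"
          by (simp add: power_mult_distrib power_add power2_eq_square del: of_nat_mult of_nat_add fact_Suc)
      qed
      finally show ?thesis by (simp add: sum_distrib_left)
    qed
    have "(\<Sum>j\<in>J. d j * (\<Sum>k<n + 2. of_real ((of_int j * h) ^ k / fact k) * U k)
      + of_real (h ^ 2) * s j * (\<Sum>k<n. of_real ((of_int j * h) ^ k / fact k) * U (2 + k)))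
      = (\<Sum>j\<in>J. \<Sum>k<n + 2. of_real (h ^ k / fact k) * U k *
          (d j * of_int j ^ k + of_nat (k * (k - 1)) * (s j * of_int j ^ (k - 2))))"
    proof (intro sum.cong refl)
      fix j
      have "of_real (h ^ 2) * s j * (\<Sum>k<n. of_real ((of_int j * h) ^ k / fact k) * U (2 + k))
         = s j * (\<Sum>k<n + 2. of_real (h ^ k / fact k) * U k * (of_nat (k * (k - 1)) * of_int j ^ (k - 2)))"
        unfolding shift[symmetric] by (simp only: ac_simps)
      then show "d j * (\<Sum>k<n + 2. of_real ((of_int j * h) ^ k / fact k) * U k)
      + of_real (h ^ 2) * s j * (\<Sum>k<n. of_real ((of_int j * h) ^ k / fact k) * U (2 + k))
        = (\<Sum>k<n + 2. of_real (h ^ k / fact k) * U k *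
          (d j * of_int j ^ k + of_nat (k * (k - 1)) * (s j * of_int j ^ (k - 2))))"
        by (simp only: sum_distrib_left flip: sum.distrib)
           (intro sum.cong refl, simp add: power_mult_distrib algebra_simps)
    qed
    also have "\<dots> = (\<Sum>k<n + 2. of_real (h ^ k / fact k) * U k * defect d s k)"
      by (subst sum.swap) (simp only: defect_def mom sum_distrib_left distrib_left sum.distrib)
    also have "\<dots> = 0" using defect by simp
    finally show ?thesis .
  qed
  have "(\<lambda>h. \<Sum>j\<in>J. d j * R j h + of_real (h ^ 2) * s j * R2 j h) \<in> O[at_right 0](\<lambda>h. of_real (h ^ (n + 2)))"
  proof (intro big_sum_in_bigo sum_in_bigo)
    fix j
    show "(\<lambda>h. d j * R j h) \<in> O[at_right 0](\<lambda>h. of_real (h ^ (n + 2)))"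
      using R[of j] by simp
    have "(\<lambda>h. s j * (of_real (h ^ 2) * R2 j h)) \<in> O[at_right 0](\<lambda>h. of_real (h ^ 2) * of_real (h ^ n))"
      using landau_o.big.mult[OF landau_o.big_refl R2[of j], of "\<lambda>h. of_real (h ^ 2)"] by simp
    moreover have "complex_of_real (h ^ 2) * of_real (h ^ n) = of_real (h ^ (n + 2))" for h
      by (simp add: power2_eq_square ac_simps)
    moreover have "s j * (of_real (h ^ 2) * R2 j h) = of_real (h ^ 2) * s j * R2 j h" for h
      by (simp only: ac_simps)
    ultimately show "(\<lambda>h. of_real (h ^ 2) * s j * R2 j h) \<in> O[at_right 0](\<lambda>h. of_real (h ^ (n + 2)))"
      by (simp only:)
  qed
  also have "(\<lambda>h. \<Sum>j\<in>J. d j * R j h + of_real (h ^ 2) * s j * R2 j h)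
    = (\<lambda>h. \<Sum>j\<in>J. d j * u (of_int j * h) + of_real (h ^ 2) * s j * D_iter 2 u (of_int j * h))"
  proof
    fix h
    have "(\<Sum>j\<in>J. d j * R j h + of_real (h ^ 2) * s j * R2 j h)
      = (\<Sum>j\<in>J. d j * u (of_int j * h) + of_real (h ^ 2) * s j * D_iter 2 u (of_int j * h)) -
        (\<Sum>j\<in>J. d j * (\<Sum>k<n + 2. of_real ((of_int j * h) ^ k / fact k) * U k)
      + of_real (h ^ 2) * s j * (\<Sum>k<n. of_real ((of_int j * h) ^ k / fact k) * U (2 + k)))"
      unfolding sum_subtractf[symmetric] R_def R2_def by (intro sum.cong refl) (simp only: right_diff_distrib, simp only: algebra_simps)
    then show "(\<Sum>j\<in>J. d j * R j h + of_real (h ^ 2) * s j * R2 j h)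
     = (\<Sum>j\<in>J. d j * u (of_int j * h) + of_real (h ^ 2) * s j * D_iter 2 u (of_int j * h))"
      unfolding main by simp
  qed
  finally show "(\<lambda>h. \<Sum>j | d j \<noteq> 0 \<or> s j \<noteq> 0.
            d j * u (of_int j * h) + of_real (h ^ 2) * s j * D_iter 2 u (of_int j * h))
        \<in> O[at_right 0](\<lambda>h. of_real (h ^ (n + 2)))" by (simp only: J_def)
qed

text \<open>Testing with \<open>u(x) = x\<^sup>k\<close>, the formula is exactly \<open>h\<^sup>k\<close> times the defect.\<close>

lemma consistentD:
  assumes "consistent n d s" and d: "d \<in> sym_seqs" and s: "s \<in> sym_seqs" and k: "k < n + 2"
  shows "defect d s k = 0"
proof -
  define J where "J = {j. d j \<noteq> 0 \<or> s j \<noteq> 0}"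
  have fin: "finite J"
    using d s unfolding J_def sym_seqs_def Collect_disj_eq by simp
  have mom: "seq_moment d k = (\<Sum>j\<in>J. d j * of_int j ^ k)" "seq_moment s k = (\<Sum>j\<in>J. s j * of_int j ^ k)" for k
    unfolding seq_moment_def by (rule sum.mono_neutral_left; use fin in \<open>auto simp: J_def\<close>)+
  define u where "u = (\<lambda>x. complex_of_real (poly (monom 1 k) x))"
  have u2: "D_iter 2 u = (\<lambda>x. of_real (real (k * (k - 1)) * x ^ (k - 2)))"
    unfolding u_def smooth_poly(1) by (simp add: numeral_2_eq_2 pderiv_monom poly_monom ac_simps)
  have val: "(\<Sum>j\<in>J. d j * u (of_int j * h) + of_real (h ^ 2) * s j * D_iter 2 u (of_int j * h))
      = of_real (h ^ k) * defect d s k" for h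
  proof -
    have "of_real (h ^ 2) * of_real (real (k * (k - 1)) * (of_int j * h) ^ (k - 2))
        = of_real (h ^ k) * (of_nat (k * (k - 1)) * of_int j ^ (k - 2) :: complex)" for j :: int
    proof (cases "k < 2")
      case True then show ?thesis by (auto simp: less_2_cases_iff)
    next
      case False
      then have "h ^ k = h ^ 2 * h ^ (k - 2)" by (metis le_add_diff_inverse not_less power_add)
      then show ?thesis by (simp add: power_mult_distrib)
    qed
    then have s_term: "of_real (h ^ 2) * s j * D_iter 2 u (of_int j * h)
        = of_real (h ^ k) * (of_nat (k * (k - 1)) * (s j * of_int j ^ (k - 2)))" for j
      unfolding u2 by (metis (no_types) mult.assoc mult.left_commute)
    have d_term: "d j * u (of_int j * h) = of_real (h ^ k) * (d j * of_int j ^ k)" for j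
      by (simp add: u_def poly_monom power_mult_distrib)
    show ?thesis unfolding s_term d_term
      by (simp only: defect_def mom sum_distrib_left distrib_left sum.distrib)
  qed
  have "smooth u" unfolding u_def by (rule smooth_poly)
  then have "(\<lambda>h. \<Sum>j\<in>J. d j * u (of_int j * h) + of_real (h ^ 2) * s j * D_iter 2 u (of_int j * h))
      \<in> O[at_right 0](\<lambda>h. of_real (h ^ (n + 2)))"
    using assms(1) unfolding consistent_def J_def[symmetric] by blast
  then have "(\<lambda>h. of_real (h ^ k) * defect d s k) \<in> O[at_right 0](\<lambda>h. of_real (h ^ (n + 2)) :: complex)"
    unfolding val .
  then obtain K where K: "eventually (\<lambda>h. norm (of_real (h ^ k) * defect d s k) \<le> K * norm (of_real (h ^ (n + 2)) :: complex)) (at_right 0)"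
    by (elim landau_o.bigE) auto
  have "eventually (\<lambda>h::real. h > 0) (at_right 0)" by (simp add: eventually_at_filter)
  with K have ev: "eventually (\<lambda>h. norm (defect d s k) \<le> K * h ^ (n + 2 - k)) (at_right 0)"
  proof eventually_elim
    case (elim h)
    have "h ^ k * norm (defect d s k) \<le> h ^ k * (K * h ^ (n + 2 - k))"
    proof -
      have "h ^ (n + 2) = h ^ k * h ^ (n + 2 - k)" using k by (simp flip: power_add)
      then show ?thesis using elim by (simp add: norm_mult norm_power mult.left_commute)
    qed
    then show ?case using elim by simp
  qed
  have "((\<lambda>h::real. K * h ^ (n + 2 - k)) \<longlongrightarrow> K * 0 ^ (n + 2 - k)) (at_right 0)"
    by (intro tendsto_intros)
  then have "norm (defect d s k) \<le> K * 0 ^ (n + 2 - k)"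
    by (rule tendsto_lowerbound[OF _ ev]) simp
  then show ?thesis using k by (simp add: power_0_left)
qed

section \<open>Lower bounds for second differences\<close>

text \<open>The supremum \<open>S\<close> of \<open>|v|\<close> is finite and satisfies \<open>S \<le> B + |a| S\<close>.\<close>

lemma geometric_recursion_bound:
  fixes v :: "int \<Rightarrow> complex"
  assumes "bounded (range v)" "norm a < 1" and rec: "\<And>i. norm (v i - a * v (i + k)) \<le> B"
  shows "norm (v i) \<le> B / (1 - norm a)"
proof -
  obtain M where M: "\<And>i. norm (v i) \<le> M" using assms(1) by (auto simp: bounded_iff)
  define S where "S = (SUP i. norm (v i))"
  have S: "norm (v i) \<le> S" for i
    unfolding S_def by (rule cSUP_upper[OF _ bdd_aboveI2[of _ _ M]]) (use M in auto)
  have "S \<le> B + norm a * S" unfolding S_def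
  proof (rule cSUP_least)
    fix i
    have "norm (v i) \<le> norm (v i - a * v (i + k)) + norm (a * v (i + k))"
      by (metis diff_add_cancel norm_triangle_ineq)
    also have "\<dots> \<le> B + norm a * S"
      unfolding norm_mult using rec[of i] S[of "i + k"] by (intro add_mono mult_left_mono) auto
    finally show "norm (v i) \<le> B + norm a * (SUP i. norm (v i))" by (simp add: S_def)
  qed simp
  then have "S \<le> B / (1 - norm a)" using assms(2) by (simp add: field_simps)
  with S[of i] show ?thesis by linarith
qed

text \<open>Write \<open>2 - z = a + 1/a\<close> with \<open>|a| \<le> 1\<close>. If \<open>|a| = 1\<close>, then \<open>z = 2 - 2 Re a\<close> lies in \<open>[0, 4]\<close>; otherwise
  \<open>a (lap - z) = (1 - a S) (1 - a S\<^bsup>-1\<^esup>)\<close> for the shift \<open>S\<close>, and each factor is bounded below by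
  \<open>1 - |a|\<close>.\<close>

lemma lap_resolvent_bound:
  assumes z: "z \<notin> of_real ` {0..4}"
  shows "\<exists>C>0. \<forall>w B. bounded (range w) \<longrightarrow> (\<forall>i. norm (lap w i - z * w i) \<le> B) \<longrightarrow> (\<forall>i. norm (w i) \<le> C * B)"
proof -
  obtain a b where ab: "a + b = 2 - z" "a * b = 1" "norm a \<le> 1"
  proof -
    define r where "r = csqrt ((2 - z)\<^sup>2 - 4)"
    have r: "r\<^sup>2 = (2 - z)\<^sup>2 - 4" by (simp add: r_def)
    define a where "a = (2 - z + r) / 2"
    define b where "b = (2 - z - r) / 2"
    have s: "a + b = 2 - z" by (simp add: a_def b_def field_simps)
    have "2 * a = 2 - z + r" "2 * b = 2 - z - r" by (simp_all add: a_def b_def)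
    then have "(2 * a) * (2 * b) = (2 - z)\<^sup>2 - r\<^sup>2"
      by (simp only:) (simp add: power2_eq_square algebra_simps)
    then have "4 * (a * b) = (2 - z)\<^sup>2 - r\<^sup>2" by simp
    then have p: "a * b = 1" by (simp add: r)
    then have "norm a * norm b = 1" by (metis norm_mult norm_one)
    then have "norm a \<le> 1 \<or> norm b \<le> 1" by (smt (verit) mult_less_cancel_left1 norm_ge_zero)
    then show ?thesis using that s p by (metis add.commute mult.commute)
  qed
  have a1: "norm a < 1"
  proof (rule ccontr)
    assume "\<not> norm a < 1"
    then have n: "norm a = 1" using ab by simp
    then have "a * cnj a = 1" by (simp flip: complex_norm_square)
    then have "b = cnj a" using ab by (metis mult.assoc mult.commute mult.left_neutral)
    then have "z = of_real (2 - 2 * Re a)" using ab(1) by (auto simp: complex_eq_iff)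
    moreover have "\<bar>Re a\<bar> \<le> 1" using abs_Re_le_cmod[of a] n by simp
    then have "2 - 2 * Re a \<in> {0..4}" by (auto simp: abs_le_iff)
    ultimately show False using z by blast
  qed
  show ?thesis
  proof (intro exI[of _ "1 / (1 - norm a)\<^sup>2"] conjI allI impI)
    show "0 < 1 / (1 - norm a)\<^sup>2" using a1 by simp
    fix w B i
    assume bd: "bounded (range w)" and B: "\<forall>i. norm (lap w i - z * w i) \<le> B"
    define v where "v = (\<lambda>i. w i - a * w (i - 1))"
    obtain M where M: "\<And>i. norm (w i) \<le> M" using bd by (auto simp: bounded_iff)
    have "norm (v i) \<le> M + norm a * M" for i
    proof -
      have "norm (v i) \<le> norm (w i) + norm (a * w (i - 1))" unfolding v_def by (rule norm_triangle_ineq4)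
      also have "\<dots> \<le> M + norm a * M"
        unfolding norm_mult by (intro add_mono mult_left_mono M) auto
      finally show ?thesis .
    qed
    then have bdv: "bounded (range v)" by (auto simp: bounded_iff)
    have "norm (v i - a * v (i + 1)) \<le> B" for i
    proof -
      have "v i - a * v (i + 1) = a * ((a + b) * w i - w (i - 1) - w (i + 1)) + (1 - a * b) * w i"
        by (simp add: v_def algebra_simps)
      also have "\<dots> = a * (lap w i - z * w i)"
        unfolding ab(1) ab(2) by (simp add: lap_def algebra_simps)
      also have "norm \<dots> \<le> 1 * B"
        unfolding norm_mult using a1 B by (intro mult_mono) auto
      finally show ?thesis by simp
    qed
    from geometric_recursion_bound[OF bdv a1 this]
    have "norm (w i - a * w (i + (-1))) \<le> B / (1 - norm a)" for i by (simp add: v_def)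
    from geometric_recursion_bound[OF bd a1 this, of i]
    show "norm (w i) \<le> 1 / (1 - norm a)\<^sup>2 * B" by (simp add: power2_eq_square)
  qed
qed

text \<open>Induction over the linear factors of \<open>p\<close>, none of whose roots lies in \<open>[0, 4]\<close>.\<close>

lemma poly_op_bounded_below:
  assumes "\<And>y. 0 \<le> y \<Longrightarrow> y \<le> 4 \<Longrightarrow> poly p (of_real y) \<noteq> 0"
  shows "\<exists>C>0. \<forall>w B. bounded (range w) \<longrightarrow> (\<forall>i. norm (poly_op p w i) \<le> B) \<longrightarrow> (\<forall>i. norm (w i) \<le> C * B)"
  using assms
proof (induction "degree p" arbitrary: p)
  case 0
  then obtain c where p: "p = [:c:]" by (metis degree_eq_zeroE)
  then have "c \<noteq> 0" using 0(2)[of 0] by simp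
  then show ?case unfolding p by (intro exI[of _ "1 / norm c"]) (auto simp: lap_def norm_mult field_simps)
next
  case (Suc n)
  then have "\<not> constant (poly p)" by (simp add: constant_degree)
  then obtain z where z: "poly p z = 0" using fundamental_theorem_of_algebra by blast
  then obtain q where q: "p = [:-z, 1:] * q" by (auto simp: poly_eq_0_iff_dvd)
  have "q \<noteq> 0" using q Suc(2) by auto
  then have "n = degree q" using Suc(2) unfolding q by (subst (asm) degree_mult_eq) auto
  moreover have "poly q (of_real y) \<noteq> 0" if "0 \<le> y" "y \<le> 4" for y
    using Suc.prems[OF that] by (auto simp: q)
  ultimately obtain C where C: "C > 0" "\<And>w B i. bounded (range w) \<Longrightarrow>
      (\<And>i. norm (poly_op q w i) \<le> B) \<Longrightarrow> norm (w i) \<le> C * B"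
    using Suc.hyps(1)[of q] by blast
  have "z \<notin> of_real ` {0..4}" using Suc.prems z by auto
  then obtain D where D: "D > 0" "\<And>w B i. bounded (range w) \<Longrightarrow>
      (\<And>i. norm (lap w i - z * w i) \<le> B) \<Longrightarrow> norm (w i) \<le> D * B"
    using lap_resolvent_bound by blast
  show ?case
  proof (intro exI[of _ "D * C"] conjI allI impI)
    show "D * C > 0" using C D by simp
    fix w B i
    assume bd: "bounded (range w)" and B: "\<forall>i. norm (poly_op p w i) \<le> B"
    define u where "u = (\<lambda>i. lap w i - z * w i)"
    have u: "poly_op [:-z, 1:] w = u" by (auto simp: u_def lap_def)
    have pu: "poly_op p w = poly_op q u" unfolding q u[symmetric] by (metis mult.commute poly_op_mult)
    obtain M where M: "\<And>i. norm (w i) \<le> M" using bd by (auto simp: bounded_iff)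
    have "norm (u i) \<le> 2 * M + M + M + norm z * M" for i
    proof -
      have "norm (u i) \<le> norm (2 * w i) + norm (w (i - 1)) + norm (w (i + 1)) + norm (z * w i)"
        unfolding u_def lap_def by (meson norm_triangle_ineq4 add_mono order_refl order_trans)
      also have "\<dots> \<le> 2 * M + M + M + norm z * M"
        unfolding norm_mult by (intro add_mono mult_mono M) auto
      finally show ?thesis .
    qed
    then have "bounded (range u)" by (auto simp: bounded_iff)
    then have "norm (u i) \<le> C * B" for i using C(2) B pu by metis
    then have "norm (w i) \<le> D * (C * B)" by (intro D(2) bd) (simp add: u_def)
    then show "norm (w i) \<le> D * C * B" by (simp add: mult.assoc)
  qed
qed

lemma lap_E_space: "w \<in> E_space N \<Longrightarrow> lap w \<in> E_space N"
proof -
  assume w: "w \<in> E_space N"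
  have odd: "w (- j) = - w j" "w (int N + 1 + j) = - w (int N + 1 - j)" for j
    using w unfolding E_space_def by blast+
  have "lap w (- j) = - lap w j" for j
    using odd(1)[of j] odd(1)[of "j - 1"] odd(1)[of "j + 1"] by (simp add: lap_def)
  moreover have "lap w (int N + 1 + j) = - lap w (int N + 1 - j)" for j
    using odd(2)[of j] odd(2)[of "j - 1"] odd(2)[of "j + 1"] by (simp add: lap_def algebra_simps)
  ultimately show ?thesis by (simp add: E_space_def)
qed

lemma poly_op_E_space: "w \<in> E_space N \<Longrightarrow> poly_op p w \<in> E_space N"
proof (induction p)
  case 0
  then show ?case by (simp add: E_space_def)
next
  case (pCons c p)
  then show ?case using lap_E_space[of "poly_op p w" N] by (simp add: E_space_def)
qed

lemma E_space_bound:
  assumes w: "w \<in> E_space N" and B: "B \<ge> 0" "\<And>j. j \<in> {1..N} \<Longrightarrow> norm (w (int j)) \<le> B"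
  shows "norm (w i) \<le> B"
proof -
  define p where "p = 2 * int N + 2"
  define r where "r = i mod p"
  have r: "0 \<le> r" "r < p" by (simp_all add: r_def p_def)
  have ir: "w i = w r"
    using E_space_periodic[OF w, of r "i div p"] by (simp add: p_def[symmetric] r_def)
  have odd: "w (- j) = - w j" "w (int N + 1 + j) = - w (int N + 1 - j)" for j
    using w unfolding E_space_def by blast+
  have zero: "w 0 = 0" "w (int N + 1) = 0" using odd(1)[of 0] odd(2)[of 0] by simp_all
  have small: "norm (w j) \<le> B" if "1 \<le> j" "j \<le> int N" for j
    using B(2)[of "nat j"] that by (simp add: nat_le_iff Suc_le_eq)
  consider "r = 0" | "1 \<le> r \<and> r \<le> int N" | "r = int N + 1" | "int N + 2 \<le> r" using r by linarith
  then have "norm (w r) \<le> B"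
  proof cases
    case 4
    have "w r = - w (p - r)" using odd(2)[of "r - int N - 1"] by (simp add: p_def algebra_simps)
    moreover have "norm (w (p - r)) \<le> B" using 4 r by (intro small) (auto simp: p_def)
    ultimately show ?thesis by simp
  qed (use zero B small in simp_all)
  then show ?thesis by (simp add: ir)
qed

text \<open>At the leftmost point where a negative minimum is attained, the left neighbour is strictly larger
  and the right neighbour not smaller, which contradicts the sign of the second difference.\<close>

lemma discrete_maximum_principle:
  fixes \<phi> :: "int \<Rightarrow> real"
  assumes bdry: "\<phi> 0 \<ge> 0" "\<phi> L \<ge> 0"
    and super: "\<And>j. 0 < j \<Longrightarrow> j < L \<Longrightarrow> 2 * \<phi> j - \<phi> (j - 1) - \<phi> (j + 1) \<ge> 0"
    and j: "0 \<le> j" "j \<le> L"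
  shows "\<phi> j \<ge> 0"
proof -
  define \<mu> where "\<mu> = Min (\<phi> ` {0..L})"
  define A where "A = {i \<in> {0..L}. \<phi> i = \<mu>}"
  have fin: "finite (\<phi> ` {0..L})" "\<phi> ` {0..L} \<noteq> {}" using j by auto
  have le: "\<mu> \<le> \<phi> i" if "i \<in> {0..L}" for i
    unfolding \<mu>_def using fin that by simp
  have "\<mu> \<in> \<phi> ` {0..L}" unfolding \<mu>_def using fin by (rule Min_in)
  moreover have "A \<subseteq> {0..L}" by (auto simp: A_def)
  ultimately have A: "finite A" "A \<noteq> {}"
    by (auto simp: A_def intro: finite_subset[of _ "{0..L}"])
  define i where "i = Min A"
  have i: "i \<in> A" unfolding i_def using A by (rule Min_in)
  have first: "i' \<notin> A" if "i' < i" for i'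
    using Min_le[OF A(1), of i'] that unfolding i_def by auto
  have "\<mu> \<ge> 0"
  proof (rule ccontr)
    assume neg: "\<not> \<mu> \<ge> 0"
    have "i \<noteq> 0" "i \<noteq> L" using i neg bdry by (auto simp: A_def)
    then have ii: "0 < i" "i < L" using i by (auto simp: A_def)
    then have "\<phi> (i - 1) \<noteq> \<mu>" using first[of "i - 1"] by (auto simp: A_def)
    moreover have "\<mu> \<le> \<phi> (i - 1)" "\<mu> \<le> \<phi> (i + 1)" using ii by (auto intro!: le)
    moreover have "\<phi> i = \<mu>" using i by (simp add: A_def)
    ultimately show False using super[OF ii] by linarith
  qed
  then show ?thesis using le[of j] j by auto
qed

text \<open>By the maximum principle, \<open>T \<psi>\<close> dominates \<open>Re (c g)\<close> for every \<open>c\<close> of modulus at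
  most 1: \<open>lap\<close> maps the parabola in \<open>\<psi>\<close> to the constant \<open>h\<^sup>2\<close>, which matches the weight of interior points, and
  the ramps \<open>min j k\<close> and \<open>min (L - j) k\<close> with \<open>k \<le> r\<close> to the indicators of the points at distance \<open>k\<close> from the
  left and the right end, which covers the points of weight 1. Yet \<open>\<psi>\<close> stays
  bounded independently of \<open>N\<close>.\<close>

lemma lap_green_bound:
  assumes g: "g \<in> E_space N"
    and T: "\<And>j. j \<in> {1..N} \<Longrightarrow> weight r N j * norm (lap g (int j)) \<le> T" and "T \<ge> 0"
  shows "norm (g i) \<le> T * (1 + 2 * (real r)\<^sup>2)"
proof (rule E_space_bound[OF g])
  fix i assume i: "i \<in> {1..N}"
  define L where "L = int N + 1"
  define h where "h = mesh N"
  have h: "h > 0" "h * of_int L = 1" by (simp_all add: h_def mesh_def L_def)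
  define \<psi> where "\<psi> = (\<lambda>j. h\<^sup>2 * of_int (j * (L - j)) / 2
      + (\<Sum>k\<in>{1..int r}. of_int (min j k) + of_int (min (L - j) k)) :: real)"
  have \<psi>_super: "2 * \<psi> j - \<psi> (j - 1) - \<psi> (j + 1) = h\<^sup>2
      + of_bool (1 \<le> j \<and> j \<le> int r) + of_bool (1 \<le> L - j \<and> L - j \<le> int r)" for j
  proof -
    have m: "2 * of_int (min j k) - of_int (min (j - 1) k) - of_int (min (j + 1) k) = (of_bool (j = k) :: real)" for j k :: int
      by (auto simp: min_def)
    have "2 * \<psi> j - \<psi> (j - 1) - \<psi> (j + 1) = h\<^sup>2 +
      (\<Sum>k\<in>{1..int r}. (2 * of_int (min j k) - of_int (min (j - 1) k) - of_int (min (j + 1) k))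
        + (2 * of_int (min (L - j) k) - of_int (min (L - j - 1) k) - of_int (min (L - j + 1) k)))"
    proof -
      define q where "q = (\<lambda>j. h\<^sup>2 * of_int (j * (L - j)) / 2)"
      define S where "S = (\<lambda>j. \<Sum>k\<in>{1..int r}. of_int (min j k) :: real)"
      have \<psi>: "\<psi> j = q j + S j + S (L - j)" for j
        by (simp only: \<psi>_def q_def S_def sum.distrib add.assoc)
      have q: "2 * q j - q (j - 1) - q (j + 1) = h\<^sup>2"
      proof -
        have "2 * (j * (L - j)) - (j - 1) * (L - (j - 1)) - (j + 1) * (L - (j + 1)) = 2"
          by (simp add: algebra_simps)
        then have "of_int (2 * (j * (L - j)) - (j - 1) * (L - (j - 1)) - (j + 1) * (L - (j + 1))) = (2 :: real)"
          by simp
        then have "h\<^sup>2 * (2 * of_int (j * (L - j)) - of_int ((j - 1) * (L - (j - 1))) - of_int ((j + 1) * (L - (j + 1)))) = h\<^sup>2 * 2"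
          by (simp only: of_int_diff of_int_mult[of 2] of_int_numeral)
        then show ?thesis unfolding q_def right_diff_distrib by linarith
      qed
      have LJ: "L - (j - 1) = L - j + 1" "L - (j + 1) = L - j - 1" by simp_all
      have "2 * \<psi> j - \<psi> (j - 1) - \<psi> (j + 1) = h\<^sup>2
          + (2 * S j - S (j - 1) - S (j + 1)) + (2 * S (L - j) - S (L - j - 1) - S (L - j + 1))"
        unfolding \<psi> LJ using q by (simp add: algebra_simps)
      then show ?thesis
        by (simp only: S_def sum.distrib sum_subtractf sum_distrib_left add.assoc)
    qed
    also have "\<dots> = h\<^sup>2 + (\<Sum>k\<in>{1..int r}. of_bool (j = k) + of_bool (L - j = k))"
      by (simp only: m)
    finally show ?thesis by (simp add: sum.distrib of_bool_def sum.delta)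
  qed
  \<comment> \<open>The rotation that makes the value at the point under consideration real and nonnegative.\<close>
  define c where "c = cnj (sgn (g (int i)))"
  have c: "norm c \<le> 1" by (simp add: c_def norm_sgn)
  have cg: "Re (c * g (int i)) = norm (g (int i))"
  proof -
    have "cnj (sgn x) * x = of_real (norm x)" for x :: complex
    proof -
      have "cnj (sgn x) * x = of_real ((norm x)\<^sup>2) / of_real (norm x)"
        unfolding complex_norm_square by (simp add: sgn_eq mult.commute)
      then show ?thesis by (simp add: power2_eq_square)
    qed
    then have "c * g (int i) = of_real (norm (g (int i)))" by (simp add: c_def)
    then show ?thesis by simp
  qed
  define \<phi> where "\<phi> = (\<lambda>j. T * \<psi> j - Re (c * g j))"
  have odd: "g (- j) = - g j" "g (int N + 1 + j) = - g (int N + 1 - j)" for j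
    using g unfolding E_space_def by blast+
  have g0: "g 0 = 0" "g L = 0" using odd(1)[of 0] odd(2)[of 0] by (simp_all add: L_def)
  have "\<phi> (int i) \<ge> 0"
  proof (rule discrete_maximum_principle[of \<phi> L])
    have "\<psi> 0 \<ge> 0" "\<psi> L \<ge> 0" unfolding \<psi>_def by (auto intro!: sum_nonneg simp: L_def)
    then show "\<phi> 0 \<ge> 0" "\<phi> L \<ge> 0" using \<open>T \<ge> 0\<close> by (simp_all add: \<phi>_def g0)
  next
    fix j assume j: "0 < j" "j < L"
    define n where "n = nat j"
    have n: "n \<in> {1..N}" "j = int n" using j by (auto simp: n_def L_def)
    have "Re (c * lap g j) \<le> norm (c * lap g j)" by (rule complex_Re_le_cmod)
    also have "\<dots> \<le> norm (lap g j)" unfolding norm_mult using c by (simp add: mult_left_le_one_le)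
    also have "\<dots> \<le> T * (2 * \<psi> j - \<psi> (j - 1) - \<psi> (j + 1))"
    proof (cases "int r < int n \<and> int n < int N + 1 - int r")
      case True
      then have "norm (lap g j) \<le> T * h\<^sup>2"
        using T[OF n(1)] n h by (simp add: weight_def h_def[symmetric] field_simps)
      also have "\<dots> \<le> T * (2 * \<psi> j - \<psi> (j - 1) - \<psi> (j + 1))"
        unfolding \<psi>_super using \<open>T \<ge> 0\<close> by (intro mult_left_mono) auto
      finally show ?thesis .
    next
      case False
      then have "weight r N n = 1" unfolding weight_def by (rule if_not_P)
      then have "norm (lap g j) \<le> T * 1" using T[OF n(1)] n(2) by simp
      also have "\<dots> \<le> T * (2 * \<psi> j - \<psi> (j - 1) - \<psi> (j + 1))"
        unfolding \<psi>_super using \<open>T \<ge> 0\<close> False j n by (intro mult_left_mono) (auto simp: L_def)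
      finally show ?thesis .
    qed
    finally show "2 * \<phi> j - \<phi> (j - 1) - \<phi> (j + 1) \<ge> 0"
      by (simp add: \<phi>_def lap_def algebra_simps)
  qed (use i in \<open>auto simp: L_def\<close>)
  then have "norm (g (int i)) \<le> T * \<psi> (int i)" unfolding \<phi>_def cg by simp
  also have "\<psi> (int i) \<le> 1 + 2 * (real r)\<^sup>2"
  proof -
    have "int i * (L - int i) \<le> L * L" using i by (intro mult_mono) (auto simp: L_def)
    then have "h\<^sup>2 * of_int (int i * (L - int i)) \<le> h\<^sup>2 * of_int (L * L)"
      by (intro mult_left_mono) (simp_all only: of_int_le_iff zero_le_power2)
    also have "\<dots> = (h * of_int L)\<^sup>2" by (simp add: power2_eq_square)
    finally have "h\<^sup>2 * of_int (int i * (L - int i)) / 2 \<le> 1" using h by simp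
    moreover have "(\<Sum>k\<in>{1..int r}. of_int (min (int i) k) + of_int (min (L - int i) k)) \<le> (\<Sum>k\<in>{1..int r}. 2 * real r)"
      by (intro sum_mono) (simp add: min_def; linarith)
    ultimately show ?thesis by (simp add: \<psi>_def power2_eq_square)
  qed
  finally show "norm (g (int i)) \<le> T * (1 + 2 * (real r)\<^sup>2)" using \<open>T \<ge> 0\<close> by (simp add: mult_left_mono)
qed (use \<open>T \<ge> 0\<close> in simp)

lemma conv_mat_mult_vec:
  assumes d: "d \<in> sym_seqs" and v: "v \<in> carrier_vec N" and j: "j \<in> {1..N}"
  shows "vec_index (conv_mat N d *\<^sub>v v) (j - 1)
    = conv_op d (\<lambda>i. \<Sum>k=1..N. vec_index v (k - 1) * E_basis N k i) (int j)"
proof -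
  let ?J = "{j. d j \<noteq> 0}"
  have "vec_index (conv_mat N d *\<^sub>v v) (j - 1)
     = (\<Sum>k=0..<N. conv_op d (E_basis N (k + 1)) (int j) * vec_index v k)"
  proof -
    have j': "j - 1 < N" "int (j - 1 + 1) = int j" using j by auto
    show ?thesis using v j' by (simp add: conv_mat_eq[OF d] scalar_prod_def del: Suc_eq_plus1)
  qed
  also have "\<dots> = (\<Sum>k=1..N. conv_op d (E_basis N k) (int j) * vec_index v (k - 1))"
    by (rule sum.reindex_bij_witness[of _ "\<lambda>k. k - 1" "\<lambda>k. k + 1"]) auto
  also have "\<dots> = (\<Sum>k=1..N. \<Sum>t\<in>?J. d t * (vec_index v (k - 1) * E_basis N k (int j - t)))"
    unfolding conv_op_def sum_distrib_right by (simp only: ac_simps)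
  also have "\<dots> = conv_op d (\<lambda>i. \<Sum>k=1..N. vec_index v (k - 1) * E_basis N k i) (int j)"
    unfolding conv_op_def sum_distrib_left by (rule sum.swap)
  finally show ?thesis .
qed

text \<open>The odd periodic extension \<open>w\<close> of a vector satisfies \<open>lap (P(lap) w) = T\<^sub>d w\<close>; the two bounds apply in turn
  to \<open>P(lap) w\<close> and to \<open>w\<close>.\<close>

lemma strongly_stable_of_symbol:
  assumes d: "d \<in> sym_seqs" "\<And>j. j > int n \<Longrightarrow> d j = 0"
    and P: "symbol d n = pCons 0 P" "\<And>y. 0 \<le> y \<Longrightarrow> y \<le> 4 \<Longrightarrow> poly P (of_real y) \<noteq> 0"
  shows "strongly_stable (\<lambda>N. conv_mat N d)"
  unfolding strongly_stable_def
proof (intro conjI allI impI)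
  show "conv_mat N d \<in> carrier_mat N N" for N by (simp add: conv_mat_eq[OF d(1)])
  obtain C where C: "C > 0" "\<And>w B i. bounded (range w) \<Longrightarrow>
      (\<And>i. norm (poly_op P w i) \<le> B) \<Longrightarrow> norm (w i) \<le> C * B"
    using poly_op_bounded_below[of P] P(2) by blast
  fix r :: nat
  define K where "K = 1 + 2 * (real r)\<^sup>2"
  have K: "K > 0" by (simp add: K_def add_pos_nonneg)
  show "\<exists>c>0. \<forall>N\<ge>1. \<forall>v\<in>carrier_vec N.
           c * Max ((\<lambda>j. cmod (vec_index v (j - 1))) ` {1..N})
             \<le> Max ((\<lambda>j. weight r N j * cmod (vec_index (conv_mat N d *\<^sub>v v) (j - 1))) ` {1..N})"
  proof (intro exI[of _ "1 / (C * K)"] conjI allI impI ballI)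
    show "0 < 1 / (C * K)" using C K by simp
    fix N :: nat and v :: "complex vec"
    assume N: "N \<ge> 1" and v: "v \<in> carrier_vec N"
    define T where "T = Max ((\<lambda>j. weight r N j * cmod (vec_index (conv_mat N d *\<^sub>v v) (j - 1))) ` {1..N})"
    define w where "w = (\<lambda>i. \<Sum>k=1..N. vec_index v (k - 1) * E_basis N k i)"
    define g where "g = poly_op P w"
    have w: "w \<in> E_space N" unfolding w_def by (rule E_space_lincomb)
    then have g: "g \<in> E_space N" unfolding g_def by (rule poly_op_E_space)
    have w_at: "w (int j) = vec_index v (j - 1)" if "j \<in> {1..N}" for j
      unfolding w_def by (rule E_lincomb_at[OF that])
    have lap_g: "lap g (int j) = vec_index (conv_mat N d *\<^sub>v v) (j - 1)" if "j \<in> {1..N}" for j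
      unfolding conv_mat_mult_vec[OF d(1) v that] w_def[symmetric] g_def
      using conv_op_eq_poly_op[OF d(1), of n w] d(2) by (simp add: P(1))
    have T: "weight r N j * norm (lap g (int j)) \<le> T" if "j \<in> {1..N}" for j
      unfolding T_def lap_g[OF that] using that by (intro Max_ge) auto
    have "0 \<le> weight r N 1 * norm (lap g (int 1))" by (auto simp: weight_def)
    also have "\<dots> \<le> T" using N by (intro T) auto
    finally have T0: "T \<ge> 0" .
    have "norm (poly_op P w i) \<le> T * K" for i
      unfolding g_def[symmetric] K_def by (rule lap_green_bound[OF g T T0])
    moreover have "bounded (range w)"
    proof -
      have "norm (w i) \<le> (\<Sum>j=1..N. norm (w (int j)))" for i
        by (rule E_space_bound[OF w]) (auto intro!: sum_nonneg member_le_sum)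
      then show ?thesis by (auto simp: bounded_iff)
    qed
    ultimately have wb: "norm (w i) \<le> C * (T * K)" for i using C(2) by blast
    have "Max ((\<lambda>j. cmod (vec_index v (j - 1))) ` {1..N}) \<le> C * (T * K)"
    proof (rule Max.boundedI)
      fix x assume "x \<in> (\<lambda>j. cmod (vec_index v (j - 1))) ` {1..N}"
      then obtain j where "j \<in> {1..N}" "x = cmod (vec_index v (j - 1))" by auto
      then show "x \<le> C * (T * K)" using wb[of "int j"] w_at by simp
    qed (use N in auto)
    then show "1 / (C * K) * Max ((\<lambda>j. cmod (vec_index v (j - 1))) ` {1..N})
             \<le> Max ((\<lambda>j. weight r N j * cmod (vec_index (conv_mat N d *\<^sub>v v) (j - 1))) ` {1..N})"
      unfolding T_def[symmetric] using C K by (simp add: field_simps)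
  qed
qed

section \<open>The optimal pair\<close>

lemma tau_le_iff:
  assumes "d \<in> sym_seqs"
  shows "tau d \<le> ereal (real n) \<longleftrightarrow> (\<forall>j>int n. d j = 0)"
proof (cases "d = (\<lambda>_. 0)")
  case True
  then show ?thesis by (simp add: tau_def)
next
  case False
  have fin: "finite {j. d j \<noteq> 0}" "{j. d j \<noteq> 0} \<noteq> {}"
    using assms False by (auto simp: sym_seqs_def)
  have "tau d \<le> ereal (real n) \<longleftrightarrow> real_of_int (Max {j. d j \<noteq> 0}) \<le> real_of_int (int n)"
    using False by (simp add: tau_def)
  also have "\<dots> \<longleftrightarrow> (\<forall>j\<in>{j. d j \<noteq> 0}. j \<le> int n)"
    unfolding of_int_le_iff by (rule Max_le_iff[OF fin])
  finally show ?thesis by (auto simp: not_less[symmetric])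
qed

lemma consistent_iff:
  assumes "d \<in> sym_seqs" "s \<in> sym_seqs"
  shows "consistent n d s \<longleftrightarrow> (\<forall>k<n + 2. defect d s k = 0)"
  using consistentI consistentD assms by blast

text \<open>Orders are natural numbers and consistency is downward closed, so the supremum cannot reach
  \<open>K\<close> without being attained.\<close>

lemma ord_pair_ge_iff:
  assumes "d \<in> sym_seqs" "s \<in> sym_seqs" "even K"
  shows "ereal (real K) \<le> ord_pair (d, s) \<longleftrightarrow> consistent K d s"
proof
  assume "consistent K d s"
  then show "ereal (real K) \<le> ord_pair (d, s)"
    unfolding ord_pair_def using assms(3) by (intro Sup_upper) auto
next
  assume le: "ereal (real K) \<le> ord_pair (d, s)"
  show "consistent K d s"
  proof (rule ccontr)
    assume no: "\<not> consistent K d s"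
    note le
    also have "ord_pair (d, s) \<le> ereal (real K - 1)"
      unfolding ord_pair_def
    proof (rule Sup_least)
      fix x assume "x \<in> {ereal (real n) |n. even n \<and> consistent n (fst (d, s)) (snd (d, s))}"
      then obtain n where n: "x = ereal (real n)" "consistent n d s" by auto
      have "n < K"
      proof (rule ccontr)
        assume "\<not> n < K"
        then have "consistent K d s"
          using n(2) unfolding consistent_iff[OF assms(1,2)] by auto
        with no show False ..
      qed
      then show "x \<le> ereal (real K - 1)" by (simp add: n)
    qed
    finally show False by simp
  qed
qed

lemma seq_moment_superset:
  assumes "finite S" "\<And>j. d j \<noteq> 0 \<Longrightarrow> j \<in> S"
  shows "seq_moment d k = (\<Sum>j\<in>S. d j * of_int j ^ k)"
  unfolding seq_moment_def by (rule sum.mono_neutral_left) (use assms in auto)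

lemma sym_seqs_comb:
  assumes "d \<in> sym_seqs" "e \<in> sym_seqs"
  shows "(\<lambda>j. d j - c * e j) \<in> sym_seqs"
proof -
  have "{j. d j - c * e j \<noteq> 0} \<subseteq> {j. d j \<noteq> 0} \<union> {j. e j \<noteq> 0}" by auto
  then show ?thesis using assms unfolding sym_seqs_def
    by (auto intro: finite_subset)
qed

lemma seq_moment_comb:
  assumes "d \<in> sym_seqs" "e \<in> sym_seqs"
  shows "seq_moment (\<lambda>j. d j - c * e j) k = seq_moment d k - c * seq_moment e k"
proof -
  define S where "S = {j. d j \<noteq> 0} \<union> {j. e j \<noteq> 0}"
  have S: "finite S" using assms by (simp add: S_def sym_seqs_def)
  have "seq_moment (\<lambda>j. d j - c * e j) k = (\<Sum>j\<in>S. (d j - c * e j) * of_int j ^ k)"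
    by (rule seq_moment_superset[OF S]) (auto simp: S_def)
  moreover have "seq_moment d k = (\<Sum>j\<in>S. d j * of_int j ^ k)" "seq_moment e k = (\<Sum>j\<in>S. e j * of_int j ^ k)"
    by (rule seq_moment_superset[OF S]; simp add: S_def)+
  ultimately show ?thesis
    by (simp add: left_diff_distrib sum_subtractf sum_distrib_left mult.assoc)
qed

lemma defect_comb:
  assumes "d \<in> sym_seqs" "s \<in> sym_seqs" "d' \<in> sym_seqs" "s' \<in> sym_seqs"
  shows "defect (\<lambda>j. d j - c * d' j) (\<lambda>j. s j - c * s' j) k = defect d s k - c * defect d' s' k"
  using assms by (simp add: defect_def seq_moment_comb algebra_simps)

text \<open>Gaussian elimination of one unknown with one equation.\<close>

lemma underdetermined_system:
  fixes a :: "nat \<Rightarrow> 'i \<Rightarrow> 'a :: field"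
  assumes "finite J" "card J > K"
  shows "\<exists>x. (\<exists>j\<in>J. x j \<noteq> 0) \<and> (\<forall>i<K. (\<Sum>j\<in>J. a i j * x j) = 0)"
  using assms
proof (induction K arbitrary: J a)
  case 0
  then have "J \<noteq> {}" by auto
  then show ?case by (intro exI[of _ "\<lambda>_. 1"]) auto
next
  case (Suc K)
  show ?case
  proof (cases "\<forall>j\<in>J. a K j = 0")
    case True
    obtain x where "\<exists>j\<in>J. x j \<noteq> 0" "\<forall>i<K. (\<Sum>j\<in>J. a i j * x j) = 0"
      using Suc.IH[of J a] Suc.prems by auto
    then show ?thesis using True by (intro exI[of _ x]) (auto simp: less_Suc_eq)
  next
    case False
    then obtain p where p: "p \<in> J" "a K p \<noteq> 0" by blast
    define J' where "J' = J - {p}"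
    have J': "finite J'" "card J' > K" "J = insert p J'" "p \<notin> J'"
      using Suc.prems p by (auto simp: J'_def)
    obtain x where x: "\<exists>j\<in>J'. x j \<noteq> 0" "\<And>i. i < K \<Longrightarrow> (\<Sum>j\<in>J'. (a i j - a i p * a K j / a K p) * x j) = 0"
      using Suc.IH[OF J'(1,2), of "\<lambda>i j. a i j - a i p * a K j / a K p"] by auto
    define t where "t = - (\<Sum>j\<in>J'. a K j * x j) / a K p"
    define y where "y = x(p := t)"
    have sum_y: "(\<Sum>j\<in>J. a i j * y j) = a i p * t + (\<Sum>j\<in>J'. a i j * x j)" for i
    proof -
      have "(\<Sum>j\<in>J'. a i j * y j) = (\<Sum>j\<in>J'. a i j * x j)"
        using J'(4) by (intro sum.cong) (auto simp: y_def)
      then show ?thesis using J' by (simp add: y_def)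
    qed
    have "(\<Sum>j\<in>J. a i j * y j) = 0" if "i < Suc K" for i
    proof (cases "i = K")
      case True
      then show ?thesis using p by (simp add: sum_y t_def)
    next
      case False
      then have "(\<Sum>j\<in>J'. a i j * x j) - a i p / a K p * (\<Sum>j\<in>J'. a K j * x j) = 0"
        using x(2)[of i] that by (simp add: left_diff_distrib sum_subtractf sum_distrib_left mult.assoc)
      then show ?thesis by (simp add: sum_y t_def)
    qed
    moreover have "\<exists>j\<in>J. y j \<noteq> 0" using x(1) J' by (auto simp: y_def)
    ultimately show ?thesis by blast
  qed
qed

definition unit_seq :: "nat \<Rightarrow> int \<Rightarrow> complex" where
  "unit_seq t j = of_bool (\<bar>j\<bar> = int t)"

definition sym_ext :: "nat \<Rightarrow> (nat \<Rightarrow> complex) \<Rightarrow> int \<Rightarrow> complex" where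
  "sym_ext n x j = (if \<bar>j\<bar> \<le> int n then x (nat \<bar>j\<bar>) else 0)"

lemma sym_ext_in_sym_seqs: "sym_ext n x \<in> sym_seqs"
proof -
  have "{j. sym_ext n x j \<noteq> 0} \<subseteq> {-int n..int n}" by (auto simp: sym_ext_def abs_le_iff split: if_splits)
  then have "finite {j. sym_ext n x j \<noteq> 0}" by (rule finite_subset) simp
  then show ?thesis by (simp add: sym_seqs_def sym_ext_def)
qed

lemma seq_moment_sym_ext:
  "seq_moment (sym_ext n x) k = (\<Sum>t\<le>n. seq_moment (unit_seq t) k * x t)"
proof -
  let ?S = "{-int n..int n}"
  have "seq_moment (sym_ext n x) k = (\<Sum>j\<in>?S. sym_ext n x j * of_int j ^ k)"
    by (rule seq_moment_superset) (auto simp: sym_ext_def abs_le_iff split: if_splits)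
  also have "\<dots> = (\<Sum>j\<in>?S. \<Sum>t\<le>n. unit_seq t j * of_int j ^ k * x t)"
  proof (intro sum.cong refl)
    fix j assume j: "j \<in> ?S"
    have "(\<Sum>t\<le>n. unit_seq t j * of_int j ^ k * x t) = (\<Sum>t\<le>n. if t = nat \<bar>j\<bar> then of_int j ^ k * x t else 0)"
      by (intro sum.cong) (auto simp: unit_seq_def)
    also have "\<dots> = sym_ext n x j * of_int j ^ k"
      using j by (auto simp: sym_ext_def)
    finally show "sym_ext n x j * of_int j ^ k = (\<Sum>t\<le>n. unit_seq t j * of_int j ^ k * x t)" by simp
  qed
  also have "\<dots> = (\<Sum>t\<le>n. \<Sum>j\<in>?S. unit_seq t j * of_int j ^ k * x t)" by (rule sum.swap)
  also have "\<dots> = (\<Sum>t\<le>n. seq_moment (unit_seq t) k * x t)"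
  proof (intro sum.cong refl)
    fix t assume "t \<in> {..n}"
    then have "seq_moment (unit_seq t) k = (\<Sum>j\<in>?S. unit_seq t j * of_int j ^ k)"
      by (intro seq_moment_superset) (auto simp: unit_seq_def abs_if split: if_splits)
    then show "(\<Sum>j\<in>?S. unit_seq t j * of_int j ^ k * x t) = seq_moment (unit_seq t) k * x t"
      by (simp add: sum_distrib_right)
  qed
  finally show ?thesis .
qed

text \<open>The values of \<open>d\<close> at \<open>0, \<dots>, l + 1\<close> and of \<open>s\<close> at \<open>0, \<dots>, m\<close> are \<open>l + m + 3\<close> unknowns, subject to
  \<open>l + m + 2\<close> equations.\<close>

lemma ex_high_order_pair:
  obtains d s where "d \<in> sym_seqs" "s \<in> sym_seqs" "\<forall>j>int (l + 1). d j = 0" "\<forall>j>int m. s j = 0"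
    "(d, s) \<noteq> (\<lambda>_. 0, \<lambda>_. 0)" "\<forall>k\<le>l + m + 1. defect d s (2 * k) = 0"
proof -
  define J where "J = Inl ` {..l + 1} \<union> (Inr ` {..m} :: (nat + nat) set)"
  have cardJ: "card J = l + m + 3"
    unfolding J_def by (subst card_Un_disjoint) (auto simp: card_image)
  define a where "a = (\<lambda>i j. case j of Inl t \<Rightarrow> seq_moment (unit_seq t) (2 * i)
     | Inr t \<Rightarrow> of_nat (2 * i * (2 * i - 1)) * seq_moment (unit_seq t) (2 * i - 2))"
  obtain x where x: "\<exists>j\<in>J. x j \<noteq> 0" "\<And>i. i < l + m + 2 \<Longrightarrow> (\<Sum>j\<in>J. a i j * x j) = 0"
    using underdetermined_system[of J "l + m + 2" a] cardJ by (auto simp: J_def)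
  define d where "d = sym_ext (l + 1) (\<lambda>t. x (Inl t))"
  define s where "s = sym_ext m (\<lambda>t. x (Inr t))"
  have "defect d s (2 * k) = 0" if "k \<le> l + m + 1" for k
  proof -
    have "(\<Sum>j\<in>J. a k j * x j) = (\<Sum>t\<le>l + 1. a k (Inl t) * x (Inl t)) + (\<Sum>t\<le>m. a k (Inr t) * x (Inr t))"
      unfolding J_def by (subst sum.union_disjoint) (auto simp: sum.reindex)
    also have "\<dots> = defect d s (2 * k)"
      by (simp only: defect_def d_def s_def seq_moment_sym_ext a_def sum.case sum_distrib_left mult.assoc)
    finally show ?thesis using x(2)[of k] that by simp
  qed
  moreover have "(d, s) \<noteq> (\<lambda>_. 0, \<lambda>_. 0)"
  proof
    assume z: "(d, s) = (\<lambda>_. 0, \<lambda>_. 0)"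
    then have "d (int t) = 0" "s (int t) = 0" for t by auto
    then have "x (Inl t) = 0" if "t \<le> l + 1" for t
      using that unfolding d_def sym_ext_def by (metis abs_of_nat nat_int of_nat_le_iff)
    moreover have "x (Inr t) = 0" if "t \<le> m" for t
      using \<open>\<And>t. s (int t) = 0\<close> that unfolding s_def sym_ext_def by (metis abs_of_nat nat_int of_nat_le_iff)
    ultimately show False using x(1) by (auto simp: J_def)
  qed
  ultimately show ?thesis
    by (intro that[of d s]) (auto simp: d_def s_def sym_ext_in_sym_seqs, auto simp: sym_ext_def)
qed

text \<open>Otherwise the reduced symbol \<open>P\<close> of \<open>symbol_factor\<close> would vanish at 0, a point of \<open>[0, 4]\<close>.\<close>

lemma high_order_pair_eq_0:
  assumes "d \<in> sym_seqs" "s \<in> sym_seqs" "\<forall>j>int (l + 1). d j = 0" "\<forall>j>int m. s j = 0"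
    and "\<And>k. k \<le> l + m + 1 \<Longrightarrow> defect d s (2 * k) = 0" "seq_moment d 2 = 0"
  shows "(d, s) = (\<lambda>_. 0, \<lambda>_. 0)"
proof (rule ccontr)
  assume nz: "(d, s) \<noteq> (\<lambda>_. 0, \<lambda>_. 0)"
  obtain P where "symbol d (l + 1) = pCons 0 P" "coeff P 0 = - seq_moment d 2 / 2"
      "\<And>y. 0 \<le> y \<Longrightarrow> y \<le> 4 \<Longrightarrow> poly P (of_real y) \<noteq> 0"
    by (rule symbol_factor[of d l s m]) (use assms nz in auto)
  from this(2) this(3)[of 0] show False using assms(6) by (simp add: poly_0_coeff_0)
qed

lemma admissible_iff:
  "admissible l m (d, s) \<longleftrightarrow> d \<in> sym_seqs \<and> s \<in> sym_seqs \<and> (d, s) \<noteq> (\<lambda>_. 0, \<lambda>_. 0) \<and>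
     (\<forall>j>int (l + 1). d j = 0) \<and> (\<forall>j>int m. s j = 0)"
  unfolding admissible_def using tau_le_iff[of d "l + 1"] tau_le_iff[of s m] by auto

text \<open>By \<open>high_order_pair_eq_0\<close>, applied to a difference, all admissible pairs of order at least \<open>2(l + m + 1)\<close> are
  proportional. Hence they share one order, which exceeds that of every other admissible pair, and exactly one of
  them is normalized.\<close>

lemma opt_pair_properties:
  obtains d s where "opt_pair l m = (d, s)" "admissible l m (d, s)" "consistent (2 * (l + m + 1)) d s"
proof -
  define K where "K = 2 * (l + m + 1)"
  define good where "good = (\<lambda>d s. admissible l m (d, s) \<and> consistent K d s)"
  have good_defect: "defect d s (2 * k) = 0" if "good d s" "k \<le> l + m + 1" for d s k
    using that consistent_iff[of d s K] by (auto simp: good_def admissible_iff K_def)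
  have goodD: "d \<in> sym_seqs" "s \<in> sym_seqs" "(d, s) \<noteq> (\<lambda>_. 0, \<lambda>_. 0)"
      "\<forall>j>int (l + 1). d j = 0" "\<forall>j>int m. s j = 0" if "good d s" for d s
    using that unfolding good_def admissible_iff by blast+
  have proportional: "(d, s) = (\<lambda>j. c * d' j, \<lambda>j. c * s' j)"
    if g: "good d s" "good d' s'" and c: "seq_moment d 2 = c * seq_moment d' 2" for d s d' s' c
  proof -
    have "(\<lambda>j. d j - c * d' j, \<lambda>j. s j - c * s' j) = (\<lambda>_. 0, \<lambda>_. 0)"
    proof (rule high_order_pair_eq_0[of _ _ l m])
      show "\<forall>j>int (l + 1). d j - c * d' j = 0" "\<forall>j>int m. s j - c * s' j = 0"
        using goodD(4,5)[OF g(1)] goodD(4,5)[OF g(2)] by simp_all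
      show "defect (\<lambda>j. d j - c * d' j) (\<lambda>j. s j - c * s' j) (2 * k) = 0" if "k \<le> l + m + 1" for k
        unfolding defect_comb[OF goodD(1,2)[OF g(1)] goodD(1,2)[OF g(2)]]
        by (simp add: good_defect[OF g(1) that] good_defect[OF g(2) that])
      show "seq_moment (\<lambda>j. d j - c * d' j) 2 = 0"
        unfolding seq_moment_comb[OF goodD(1)[OF g(1)] goodD(1)[OF g(2)]] using c by simp
    qed (intro sym_seqs_comb goodD(1,2)[OF g(1)] goodD(1,2)[OF g(2)])+
    then show ?thesis by (simp add: fun_eq_iff)
  qed
  have nonzero_moment: "seq_moment d 2 \<noteq> 0" if g: "good d s" for d s
    using high_order_pair_eq_0[OF goodD(1,2,4,5)[OF g] good_defect[OF g]] goodD(3)[OF g] by blast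
  obtain e f where ef: "e \<in> sym_seqs" "f \<in> sym_seqs" "\<forall>j>int (l + 1). e j = 0" "\<forall>j>int m. f j = 0"
    "(e, f) \<noteq> (\<lambda>_. 0, \<lambda>_. 0)" "\<forall>k\<le>l + m + 1. defect e f (2 * k) = 0"
    by (rule ex_high_order_pair[of l m])
  have odd_defect: "defect d s k = 0" if "d \<in> sym_seqs" "s \<in> sym_seqs" "odd k" for d s k
    using that odd_moment[of d k] odd_moment[of s "k - 2"] by (cases "k = 1") (auto simp: defect_def)
  have "consistent K e f"
    unfolding consistent_iff[OF ef(1,2)]
  proof (intro allI impI)
    fix k assume k: "k < K + 2"
    show "defect e f k = 0"
    proof (cases "even k")
      case True
      then obtain i where "k = 2 * i" by blast
      then show ?thesis using ef(6) k by (simp add: K_def)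
    qed (rule odd_defect[OF ef(1,2)])
  qed
  then have "good e f" using ef by (simp add: good_def admissible_iff)
  define c where "c = - 2 / seq_moment e 2"
  define d where "d = (\<lambda>j. c * e j)"
  define s where "s = (\<lambda>j. c * f j)"
  have c: "c \<noteq> 0" using nonzero_moment[OF \<open>good e f\<close>] by (simp add: c_def)
  have scale: "(\<lambda>j. c * b j) \<in> sym_seqs" "seq_moment (\<lambda>j. c * b j) k = c * seq_moment b k"
    if "b \<in> sym_seqs" for b k
  proof -
    have "(\<lambda>_. 0) \<in> sym_seqs" by (simp add: sym_seqs_def)
    from sym_seqs_comb[OF this that, of "- c"] seq_moment_comb[OF this that, of "- c" k]
    show "(\<lambda>j. c * b j) \<in> sym_seqs" "seq_moment (\<lambda>j. c * b j) k = c * seq_moment b k"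
      by (simp_all add: seq_moment_def)
  qed
  have good: "good d s"
  proof -
    have "defect d s k = c * defect e f k" for k
      using ef by (simp add: defect_def d_def s_def scale algebra_simps)
    then have "consistent K d s"
      using \<open>consistent K e f\<close> ef scale by (simp add: consistent_iff d_def s_def)
    moreover have "(d, s) \<noteq> (\<lambda>_. 0, \<lambda>_. 0)" using ef(5) c by (auto simp: d_def s_def fun_eq_iff)
    ultimately show ?thesis using ef scale by (auto simp: good_def admissible_iff d_def s_def)
  qed
  have norm: "seq_moment d 2 = - 2"
    using ef scale nonzero_moment[OF \<open>good e f\<close>] by (simp add: d_def c_def)
  have goodI: "good d' s'" if "admissible l m (d', s')" "\<not> ord_pair (d', s') < ord_pair (d, s)" for d' s'
  proof -
    have "ereal (real K) \<le> ord_pair (d, s)"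
      using good ord_pair_ge_iff[of d s K] by (auto simp: good_def admissible_iff K_def)
    also have "\<dots> \<le> ord_pair (d', s')" using that(2) by (simp add: not_less)
    finally show ?thesis using that(1) ord_pair_ge_iff[of d' s' K] by (auto simp: good_def admissible_iff K_def)
  qed
  \<comment> \<open>Scaling by a nonzero factor preserves the vanishing of the defects.\<close>
  have same_ord: "ord_pair (d', s') = ord_pair (d, s)" if g: "good d' s'" for d' s'
  proof -
    define b where "b = seq_moment d' 2 / seq_moment d 2"
    have b: "b \<noteq> 0" using nonzero_moment[OF g] norm by (simp add: b_def)
    have eq: "(d', s') = (\<lambda>j. b * d j, \<lambda>j. b * s j)"
      using norm by (intro proportional g good) (simp add: b_def)
    have sym: "d \<in> sym_seqs" "s \<in> sym_seqs" "d' \<in> sym_seqs" "s' \<in> sym_seqs"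
      using g good by (auto simp: good_def admissible_iff)
    have "defect d' s' k = b * defect d s k" for k
    proof -
      have z: "(\<lambda>_. 0) \<in> sym_seqs" by (simp add: sym_seqs_def)
      have "defect d' s' k = defect (\<lambda>j. 0 - (- b) * d j) (\<lambda>j. 0 - (- b) * s j) k" using eq by simp
      also have "\<dots> = b * defect d s k"
        unfolding defect_comb[OF z z sym(1,2)] by (simp add: defect_def seq_moment_def)
      finally show ?thesis .
    qed
    then have "consistent n d' s' \<longleftrightarrow> consistent n d s" for n
      using b sym by (simp add: consistent_iff)
    then show ?thesis by (simp add: ord_pair_def)
  qed
  have moment2: "(\<Sum>j | d' j \<noteq> 0. d' j * of_int (j ^ 2)) = seq_moment d' 2" for d'
    by (simp add: seq_moment_def)
  have "opt_pair l m = (d, s)"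
    unfolding opt_pair_def
  proof (rule the_equality, goal_cases)
    case 1
    have "\<not> ord_pair q > ord_pair (d, s)" if "admissible l m q" for q
      using goodI[of "fst q" "snd q"] same_ord[of "fst q" "snd q"] that
      by (cases q) (auto dest: order.asym)
    then show ?case using good norm
      by (auto simp: is_arg_max_def good_def moment2 simp del: of_int_power)
  next
    case (2 p)
    obtain d' s' where p: "p = (d', s')" by (cases p)
    have "good d' s'"
      using 2 good by (intro goodI) (auto simp: is_arg_max_def p good_def)
    moreover have "seq_moment d' 2 = 1 * seq_moment d 2"
      using 2 norm by (simp add: p moment2 del: of_int_power)
    ultimately show ?case using proportional[OF _ good, of d' s' 1] p by simp
  qed
  then show ?thesis using good that by (auto simp: good_def K_def)
qed

theorem theorem2p8:
  fixes l m :: nat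
  assumes "l \<ge> 1"
  shows "strongly_stable (\<lambda>N. conv_mat N (d_opt l m))"
proof -
  obtain d s where ds: "opt_pair l m = (d, s)" "admissible l m (d, s)" "consistent (2 * (l + m + 1)) d s"
    by (rule opt_pair_properties)
  then have sym: "d \<in> sym_seqs" "s \<in> sym_seqs" and supp: "\<And>j. j > int (l + 1) \<Longrightarrow> d j = 0"
      "\<And>j. j > int m \<Longrightarrow> s j = 0" and nz: "(d, s) \<noteq> (\<lambda>_. 0, \<lambda>_. 0)"
    by (auto simp: admissible_iff)
  have "defect d s (2 * k) = 0" if "k \<le> l + m + 1" for k
    using ds(3) that by (simp add: consistent_iff[OF sym])
  then obtain P where "symbol d (l + 1) = pCons 0 P"
      "\<And>y. 0 \<le> y \<Longrightarrow> y \<le> 4 \<Longrightarrow> poly P (of_real y) \<noteq> 0"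
    using symbol_factor[OF sym(1) supp(1) sym(2) supp(2) _ nz] by blast
  then have "strongly_stable (\<lambda>N. conv_mat N d)"
    by (intro strongly_stable_of_symbol[OF sym(1) supp(1)])
  then show ?thesis by (simp add: d_opt_def ds(1))
qed

end
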